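(* Let the parameters be regular, let $\boldsymbol n\in\mathbb N_0^p$, $\boldsymbol m\in\mathbb N_0^q$ with $|\boldsymbol m|=|\boldsymbol n|+1$ and $\boldsymbol m$ near the diagonal, and let the parameters be admissible for $\boldsymbol m$. Let $M,\mathcal J_+,\mathcal J_-,\mathcal F_j$ be as in the context. Then for every $H\in\mathcal J_+$, $$\deg B^{(H)}_{\boldsymbol n,\boldsymbol m}=m_H-1 .$$ The only components which may lose their highest allowed degree are those indexed by $\mathcal J_-$, and for $j\in\mathcal J_-$, $$\deg B^{(j)}_{\boldsymbol n,\boldsymbol m}<m_j-1\iff\mathcal F_j=0 .$$ Consequently, inside the admissible regular parameter domain, $B$-strong normality (one-dimensional solution space and $\deg B^{(j)}_{\boldsymbol n,\boldsymbol m}=m_j-1$ for every $j$ with $m_j\ge1$) holds on the complement of the finite union of algebraic exceptional sets $\mathcal E^B_{\boldsymbol n,\boldsymbol m}=\bigcup_{j\in\mathcal J_-}\{\mathcal F_j=0\}$. In particular, if $\boldsymbol m$ is diagonal (all components equal), then $\mathcal J_-=\varnothing$ and the $B$-polynomial vector is strongly normal.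
   Context: Notation. $\mathbf 1_d$: all-ones vector; $\boldsymbol e_j$: standard basis vector; $|\boldsymbol n|=\sum n_i$; $\boldsymbol c^{*i}$: $\boldsymbol c$ with its $i$-th component removed. $(x)_n=\Gamma(x+n)/\Gamma(x)=x(x+1)\cdots(x+n-1)$; for vectors $\Gamma(\boldsymbol v)=\prod_h\Gamma(v_h)$, $(\boldsymbol c)_{\boldsymbol m}=\prod_h(c_h)_{m_h}$, a scalar subscript is applied to each component; empty products are $1$. $\mathbb P_N$: polynomials of degree $\le N$, $\mathbb P_{-1}=\{0\}$; the zero polynomial has degree $-\infty$. $\mathbb T$: positively oriented unit circle. $\mathbb Z_{\le0}=\{0,-1,\dots\}$. Parameters: $p,q\ge1$, $0\le r<q$, $\boldsymbol a\in\mathbb C^r$, $\boldsymbol b\in\mathbb C^q$, $\boldsymbol\kappa\in\mathbb C^p$; regular: $b_j-b_h\notin\mathbb Z$ $(j\ne h)$, $\kappa_i-\kappa_h\notin\mathbb Z$ $(i\ne h)$. Weights: $C_{j,i}(z)=\sum_{k\ge0}\frac{\Gamma((k+\kappa_i)\mathbf 1_r+\boldsymbol a+\mathbf 1_r)}{\Gamma((k+\kappa_i)\mathbf 1_q+\boldsymbol b+\boldsymbol e_j+\mathbf 1_q)}z^{-k-1}$. Near the diagonal: $|m_j-m_h|\le1$ for all $j,h$. Admissible for $\boldsymbol m$: for all $i,j,\rho$, $\kappa_i+a_\rho+1\notin\mathbb Z_{\le0}$, $\kappa_i+b_j+1\notin\mathbb Z_{\le0}$; $a_\rho-b_j-m_j+1\notin\mathbb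 Z_{\le0}$ whenever $m_j\ge1$. $\mathbf B_{\boldsymbol n,\boldsymbol m}=(B^{(1)}_{\boldsymbol n,\boldsymbol m},\dots,B^{(q)}_{\boldsymbol n,\boldsymbol m})$ denotes the $B$-polynomial vector, i.e. the nonzero solution, unique up to a nonzero scalar under these hypotheses, of: $B^{(j)}\in\mathbb P_{m_j-1}$ and $\sum_{j=1}^q\oint_{\mathbb T}z^\ell B^{(j)}(z)C_{j,i}(z)\frac{\mathrm dz}{2\pi\mathrm i}=0$ for $1\le i\le p$, $0\le\ell\le n_i-1$. $M=\max_hm_h$; $\mathcal J_+=\{H:m_H=M\}$; $\mathcal J_-=\{j:m_j=M-1,\ m_j\ge1\}$. For $H\in\mathcal J_+$, $\boldsymbol b_+^{*H}$ is the vector $(b_L)_{L\in\mathcal J_+}$ with $b_H$ deleted. For $j\in\mathcal J_-$, $$\begin{aligned}\mathcal F_j=&-\frac{(\boldsymbol\kappa+(b_j+M-1)\mathbf 1_p)_{\boldsymbol n}}{(-M+2)_{M-2}\,(\boldsymbol b^{*j}-(b_j+M-2)\mathbf 1_{q-1})_{\boldsymbol m^{*j}}}+\frac{(\boldsymbol a-b_j\mathbf 1_r-(M-2)\mathbf 1_r)_{M-1}}{(-M+2)_{M-2}\,(\boldsymbol b^{*j}-(b_j+M-2)\mathbf 1_{q-1})_{(M-1)\mathbf 1_{q-1}}}\\&\times\sum_{H:\,m_H=M}\frac{(\boldsymbol\kappa+(b_H+M)\mathbf 1_p)_{\boldsymbol n}}{(\boldsymbol a-b_H\mathbf 1_r-(M-1)\mathbf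 1_r)_{M-1}\,(b_H-b_j+1)\,(\boldsymbol b_+^{*H}-b_H\mathbf 1_{|\mathcal J_+|-1})_1}.\end{aligned}$$ *)

theory Defs
  imports
    "HOL-Complex_Analysis.Complex_Analysis"
    "HOL-Library.Function_Algebras"
    "HOL-Library.Extended_Real"
begin

text \<open>
  Vectors are functions on \<^typ>\<open>nat\<close> of which only the components with index in
  \<open>{1..r}\<close>, \<open>{1..q}\<close> or \<open>{1..p}\<close> are ever looked at.  A parameter point is a triple \<open>(a, b, \<kappa>)\<close>
  with \<open>a \<in> \<complex>\<^sup>r\<close>, \<open>b \<in> \<complex>\<^sup>q\<close>, \<open>\<kappa> \<in> \<complex>\<^sup>p\<close>.
\<close>

type_synonym params = "(nat \<Rightarrow> complex) \<times> (nat \<Rightarrow> complex) \<times> (nat \<Rightarrow> complex)"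

definition regular :: "nat \<Rightarrow> nat \<Rightarrow> params \<Rightarrow> bool" where
  "regular p q = (\<lambda>(a, b, \<kappa>).
     (\<forall>j\<in>{1..q}. \<forall>h\<in>{1..q}. j \<noteq> h \<longrightarrow> b j - b h \<notin> \<int>) \<and>
     (\<forall>i\<in>{1..p}. \<forall>h\<in>{1..p}. i \<noteq> h \<longrightarrow> \<kappa> i - \<kappa> h \<notin> \<int>))"

text \<open>The conditions on \<open>\<kappa> i + b j + 1\<close> are required also when \<open>r = 0\<close>.\<close>

definition admissible :: "nat \<Rightarrow> nat \<Rightarrow> nat \<Rightarrow> (nat \<Rightarrow> nat) \<Rightarrow> params \<Rightarrow> bool" where
  "admissible p q r m = (\<lambda>(a, b, \<kappa>).
     (\<forall>i\<in>{1..p}. \<forall>\<rho>\<in>{1..r}. \<kappa> i + a \<rho> + 1 \<notin> \<int>\<^sub>\<le>\<^sub>0) \<and>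
     (\<forall>i\<in>{1..p}. \<forall>j\<in>{1..q}. \<kappa> i + b j + 1 \<notin> \<int>\<^sub>\<le>\<^sub>0) \<and>
     (\<forall>\<rho>\<in>{1..r}. \<forall>j\<in>{1..q}. m j \<ge> 1 \<longrightarrow> a \<rho> - b j - of_nat (m j) + 1 \<notin> \<int>\<^sub>\<le>\<^sub>0))"

definition param_domain :: "nat \<Rightarrow> nat \<Rightarrow> nat \<Rightarrow> (nat \<Rightarrow> nat) \<Rightarrow> params set" where
  "param_domain p q r m = {x. regular p q x \<and> admissible p q r m x}"

definition near_diagonal :: "nat \<Rightarrow> (nat \<Rightarrow> nat) \<Rightarrow> bool" where
  "near_diagonal q m \<longleftrightarrow> (\<forall>j\<in>{1..q}. \<forall>h\<in>{1..q}. \<bar>int (m j) - int (m h)\<bar> \<le> 1)"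

text \<open>The weights \<open>C\<^sub>j\<^sub>,\<^sub>i(z)\<close>; the vector \<open>e\<^sub>j\<close> contributes 1 to the component \<open>h = j\<close>.\<close>

definition weight ::
  "nat \<Rightarrow> nat \<Rightarrow> params \<Rightarrow> nat \<Rightarrow> nat \<Rightarrow> complex \<Rightarrow> complex" where
  "weight q r = (\<lambda>(a, b, \<kappa>) j i z.
     \<Sum>k. (\<Prod>\<rho>=1..r. Gamma (of_nat k + \<kappa> i + a \<rho> + 1)) /
          (\<Prod>h=1..q. Gamma (of_nat k + \<kappa> i + b h + (if h = j then 1 else 0) + 1)) *
          z powi (- int k - 1))"

text \<open>Degree with the convention that the zero polynomial has degree \<open>-\<infinity>\<close>.\<close>

definition deg :: "complex poly \<Rightarrow> ereal" where
  "deg f = (if f = 0 then -\<infinity> else ereal (real (degree f)))"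

text \<open>Complex vector space structure on families of polynomials.\<close>

definition smult_vec :: "complex \<Rightarrow> (nat \<Rightarrow> complex poly) \<Rightarrow> nat \<Rightarrow> complex poly" where
  "smult_vec c B = (\<lambda>j. smult c (B j))"

global_interpretation poly_vec: vector_space smult_vec
  by unfold_locales
    (auto simp: smult_vec_def fun_eq_iff smult_add_right smult_add_left)

text \<open>
  The space of solutions \<open>B = (B\<^sup>1, \<dots>, B\<^sup>q)\<close>, zero included, of the orthogonality conditions.  Components outside
  \<open>{1..q}\<close> are set to zero, so that distinct functions are distinct vectors.  For \<open>m j = 0\<close> the degree bound
  is \<open>-1\<close> and says \<open>B j = 0\<close>.
\<close>

definition B_solutions ::
  "nat \<Rightarrow> nat \<Rightarrow> nat \<Rightarrow> (nat \<Rightarrow> nat) \<Rightarrow> (nat \<Rightarrow> nat) \<Rightarrow> params \<Rightarrow> (nat \<Rightarrow> complex poly) set" where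
  "B_solutions p q r n m x = {B.
     (\<forall>j\<in>{1..q}. deg (B j) \<le> ereal (real (m j) - 1)) \<and>
     (\<forall>j. j \<notin> {1..q} \<longrightarrow> B j = 0) \<and>
     (\<forall>i\<in>{1..p}. \<forall>l<n i.
        (\<Sum>j=1..q. contour_integral (circlepath 0 1)
           (\<lambda>z. z ^ l * poly (B j) z * weight q r x j i z / (2 * of_real pi * \<i>))) = 0)}"

definition B_strongly_normal ::
  "nat \<Rightarrow> nat \<Rightarrow> nat \<Rightarrow> (nat \<Rightarrow> nat) \<Rightarrow> (nat \<Rightarrow> nat) \<Rightarrow> params \<Rightarrow> bool" where
  "B_strongly_normal p q r n m x \<longleftrightarrow>
     poly_vec.dim (B_solutions p q r n m x) = 1 \<and>
     (\<forall>B\<in>B_solutions p q r n m x - {0}.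
        \<forall>j\<in>{1..q}. m j \<ge> 1 \<longrightarrow> deg (B j) = ereal (real (m j) - 1))"

definition max_index :: "nat \<Rightarrow> (nat \<Rightarrow> nat) \<Rightarrow> nat" where
  "max_index q m = Max (m ` {1..q})"

definition J_plus :: "nat \<Rightarrow> (nat \<Rightarrow> nat) \<Rightarrow> nat set" where
  "J_plus q m = {H\<in>{1..q}. m H = max_index q m}"

definition J_minus :: "nat \<Rightarrow> (nat \<Rightarrow> nat) \<Rightarrow> nat set" where
  "J_minus q m = {j\<in>{1..q}. m j = max_index q m - 1 \<and> m j \<ge> 1}"

text \<open>
  \<open>\<F>\<^sub>j\<close>, meaningful for \<open>j \<in> J_minus q m\<close>; then \<open>M \<ge> 2\<close>, so the truncated subtractions
  \<open>M - 1\<close> and \<open>M - 2\<close> in the subscripts are exact.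
\<close>

definition F_exc ::
  "nat \<Rightarrow> nat \<Rightarrow> nat \<Rightarrow> (nat \<Rightarrow> nat) \<Rightarrow> (nat \<Rightarrow> nat) \<Rightarrow> nat \<Rightarrow> params \<Rightarrow> complex" where
  "F_exc p q r n m j = (\<lambda>(a, b, \<kappa>).
     (let M = max_index q m; cM = (of_nat M :: complex) in
      - ((\<Prod>i=1..p. pochhammer (\<kappa> i + (b j + cM - 1)) (n i)) /
         (pochhammer (- cM + 2) (M - 2) *
          (\<Prod>h\<in>{1..q} - {j}. pochhammer (b h - (b j + cM - 2)) (m h))))
      + (\<Prod>\<rho>=1..r. pochhammer (a \<rho> - b j - (cM - 2)) (M - 1)) /
        (pochhammer (- cM + 2) (M - 2) *
         (\<Prod>h\<in>{1..q} - {j}. pochhammer (b h - (b j + cM - 2)) (M - 1)))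
        * (\<Sum>H\<in>J_plus q m.
            (\<Prod>i=1..p. pochhammer (\<kappa> i + (b H + cM)) (n i)) /
            ((\<Prod>\<rho>=1..r. pochhammer (a \<rho> - b H - (cM - 1)) (M - 1)) *
             (b H - b j + 1) *
             (\<Prod>L\<in>J_plus q m - {H}. pochhammer (b L - b H) 1)))))"

definition exceptional_set ::
  "nat \<Rightarrow> nat \<Rightarrow> nat \<Rightarrow> (nat \<Rightarrow> nat) \<Rightarrow> (nat \<Rightarrow> nat) \<Rightarrow> nat \<Rightarrow> params set" where
  "exceptional_set p q r n m j = {x\<in>param_domain p q r m. F_exc p q r n m j x = 0}"

text \<open>
  Polynomial functions of the coordinates \<open>a\<^sub>1, \<dots>, a\<^sub>r, b\<^sub>1, \<dots>, b\<^sub>q, \<kappa>\<^sub>1, \<dots>, \<kappa>\<^sub>p\<close>, and the subsets of \<open>D\<close> cut out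
  by finitely many of them.
\<close>

inductive_set param_polys :: "nat \<Rightarrow> nat \<Rightarrow> nat \<Rightarrow> (params \<Rightarrow> complex) set" for p q r where
  const: "(\<lambda>_. c) \<in> param_polys p q r"
| coord_a: "\<rho> \<in> {1..r} \<Longrightarrow> (\<lambda>(a, b, \<kappa>). a \<rho>) \<in> param_polys p q r"
| coord_b: "j \<in> {1..q} \<Longrightarrow> (\<lambda>(a, b, \<kappa>). b j) \<in> param_polys p q r"
| coord_kappa: "i \<in> {1..p} \<Longrightarrow> (\<lambda>(a, b, \<kappa>). \<kappa> i) \<in> param_polys p q r"
| add: "f \<in> param_polys p q r \<Longrightarrow> g \<in> param_polys p q r \<Longrightarrow> (\<lambda>x. f x + g x) \<in> param_polys p q r"
| mult: "f \<in> param_polys p q r \<Longrightarrow> g \<in> param_polys p q r \<Longrightarrow> (\<lambda>x. f x * g x) \<in> param_polys p q r"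

definition algebraic_in :: "nat \<Rightarrow> nat \<Rightarrow> nat \<Rightarrow> params set \<Rightarrow> params set \<Rightarrow> bool" where
  "algebraic_in p q r D S \<longleftrightarrow>
     (\<exists>T. finite T \<and> T \<subseteq> param_polys p q r \<and> S = {x\<in>D. \<forall>f\<in>T. f x = 0})"

end

theory Submission
  imports Defs
begin

text \<open>
  On the unit circle the orthogonality conditions only see the Laurent coefficients of the weights.
  At \<open>s = \<kappa> i + l\<close>, and up to a common nonzero factor, the condition with indices \<open>i\<close>, \<open>l\<close> says that
  \<open>Q\<close> vanishes at \<open>s\<close>, where \<open>Q\<close> combines explicit functions of \<open>s\<close> linearly with the coefficients
  of the \<open>B j\<close>; the near-diagonal hypothesis makes these functions polynomials of degree at most \<open>|n|\<close>.  Hence \<open>Q\<close> is a multiple of the polynomial whose roots are the \<open>|n|\<close> nodes \<open>\<kappa> i + l\<close>.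
  The basis polynomial with indices \<open>j\<close>, \<open>k\<close> vanishes at \<open>- b J - K - 1\<close> whenever \<open>k \<le> K\<close>, except
  for \<open>(j, k) = (J, K)\<close>.  This triangular structure makes the map from \<open>B\<close> to \<open>Q\<close> injective, and
  the values of \<open>Q\<close> at \<open>- b H - M\<close> and \<open>- b j - (M - 1)\<close> determine the leading coefficients: the former are
  nonzero, and the latter turn out to be proportional to \<open>\<F>\<^sub>j\<close>.
\<close>

subsection \<open>Moments of the weights\<close>

lemma has_contour_integral_powi_circlepath:
  "((\<lambda>z. z powi k) has_contour_integral (if k = - 1 then 2 * of_real pi * \<i> else 0)) (circlepath 0 1)"
proof (cases "k = - 1")
  case True
  \<comment> \<open>A non-integrable function has contour integral 0 by default, so the nonzero
    value 2 pi i already forces integrability.\<close>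
  have "(\<lambda>w. 1 / (w - 0)) contour_integrable_on circlepath 0 1"
    using contour_integral_circlepath[of 1 0, OF zero_less_one]
    by (rule contrapos_pp) (simp add: not_integrable_contour_integral)
  then have "((\<lambda>w. 1 / (w - 0)) has_contour_integral 2 * of_real pi * \<i>) (circlepath 0 1)"
    by (metis contour_integral_circlepath has_contour_integral_integral zero_less_one)
  then show ?thesis
    using True by (simp add: power_int_minus field_simps)
next
  case False
  then have k: "of_int (k + 1) \<noteq> (0 :: complex)"
    by (subst of_int_eq_0_iff) auto
  have "((\<lambda>z. z powi (k + 1) / of_int (k + 1)) has_field_derivative z powi k) (at z within - {0})"
    if "z \<in> - {0}" for z :: complex
    using that k by (auto intro!: derivative_eq_intros simp del: of_int_add)
  then have "((\<lambda>z. z powi k) has_contour_integral 0) (circlepath 0 1)"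
    by (rule Cauchy_theorem_primitive) auto
  with False show ?thesis by simp
qed

text \<open>On the unit circle summable coefficients make the Laurent series converge uniformly
  (Weierstrass), so termwise integration is allowed. Of the powers
  \<open>z powi (l + k' - k - 1)\<close> only those with \<open>k = l + k'\<close>
  contribute.\<close>

lemma contour_integral_poly_mult_Laurent:
  assumes c: "summable (\<lambda>k. norm (c k))"
  shows "contour_integral (circlepath 0 1)
           (\<lambda>z. z ^ l * poly P z * (\<Sum>k. c k * z powi (- int k - 1)) / (2 * of_real pi * \<i>)) =
         (\<Sum>k\<le>degree P. coeff P k * c (l + k))"
proof -
  define h where "h z = z ^ l * poly P z / (2 * of_real pi * \<i>)" for z
  have "bounded (h ` sphere 0 1)"
    unfolding h_def by (intro compact_imp_bounded compact_continuous_image continuous_intros) auto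
  then obtain C where C: "norm (h z) \<le> C" if "z \<in> sphere 0 1" for z
    unfolding bounded_iff ball_simps by blast
  have lim: "uniform_limit (sphere 0 1) (\<lambda>N z. \<Sum>k<N. h z * (c k * z powi (- int k - 1)))
     (\<lambda>z. \<Sum>k. h z * (c k * z powi (- int k - 1))) sequentially"
  proof (rule Weierstrass_m_test)
    show "summable (\<lambda>k. C * norm (c k))"
      using c by (rule summable_mult)
    show "norm (h z * (c k * z powi (- int k - 1))) \<le> C * norm (c k)" if "z \<in> sphere 0 1" for k z
      using that C[OF that]
      by (auto simp: norm_mult norm_power_int intro: mult_right_mono)
  qed
  have part: "((\<lambda>z. \<Sum>k<N. h z * (c k * z powi (- int k - 1))) has_contour_integral
       (\<Sum>k<N. \<Sum>k'\<le>degree P. if k = l + k' then coeff P k' * c k else 0)) (circlepath 0 1)" for N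
  proof -
    have "((\<lambda>z. \<Sum>k<N. \<Sum>k'\<le>degree P. coeff P k' * c k / (2 * of_real pi * \<i>) *
              z powi (int l + int k' - int k - 1)) has_contour_integral
       (\<Sum>k<N. \<Sum>k'\<le>degree P. coeff P k' * c k / (2 * of_real pi * \<i>) *
          (if int l + int k' - int k - 1 = - 1 then 2 * of_real pi * \<i> else 0))) (circlepath 0 1)"
      by (intro has_contour_integral_sum has_contour_integral_lmul
            has_contour_integral_powi_circlepath) auto
    also have "(\<Sum>k<N. \<Sum>k'\<le>degree P. coeff P k' * c k / (2 * of_real pi * \<i>) *
          (if int l + int k' - int k - 1 = - 1 then 2 * of_real pi * \<i> else 0)) =
        (\<Sum>k<N. \<Sum>k'\<le>degree P. if k = l + k' then coeff P k' * c k else 0)"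
      by (intro sum.cong refl) auto
    finally show ?thesis
    proof (rule has_contour_integral_eq)
      fix z :: complex
      assume "z \<in> path_image (circlepath 0 1)"
      then have "z \<noteq> 0" by auto
      then have powi: "z powi (int l + int k' - int k - 1) = z ^ l * z ^ k' * z powi (- int k - 1)"
        for k k'
        using power_int_add[of z "int l + int k'" "- int k - 1"]
        by (simp add: power_int_add algebra_simps)
      show "(\<Sum>k<N. \<Sum>k'\<le>degree P. coeff P k' * c k / (2 * of_real pi * \<i>) *
              z powi (int l + int k' - int k - 1)) = (\<Sum>k<N. h z * (c k * z powi (- int k - 1)))"
        unfolding powi h_def poly_altdef sum_distrib_left sum_distrib_right sum_divide_distrib
        by (intro sum.cong refl) simp
    qed
  qed
  have L: "(\<lambda>N. contour_integral (circlepath 0 1) (\<lambda>z. \<Sum>k<N. h z * (c k * z powi (- int k - 1))))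
     \<longlonglongrightarrow> contour_integral (circlepath 0 1) (\<lambda>z. \<Sum>k. h z * (c k * z powi (- int k - 1)))"
    using part lim
    by (intro contour_integral_uniform_limit_circlepath)
       (auto simp: contour_integrable_on_def intro!: always_eventually)
  \<comment> \<open>Once \<open>N > l + degree P\<close>, every index \<open>l + k'\<close> lies
    below \<open>N\<close>: the partial integrals are constant from there on, and their limit is the
    finite sum.\<close>
  have ev: "eventually (\<lambda>N. contour_integral (circlepath 0 1)
      (\<lambda>z. \<Sum>k<N. h z * (c k * z powi (- int k - 1))) = (\<Sum>k\<le>degree P. coeff P k * c (l + k)))
      sequentially"
    using eventually_gt_at_top[of "l + degree P"]
  proof eventually_elim
    case (elim N)
    have "contour_integral (circlepath 0 1) (\<lambda>z. \<Sum>k<N. h z * (c k * z powi (- int k - 1))) =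
        (\<Sum>k<N. \<Sum>k'\<le>degree P. if k = l + k' then coeff P k' * c k else 0)"
      by (rule contour_integral_unique[OF part])
    also have "\<dots> = (\<Sum>k'\<le>degree P. \<Sum>k<N. if k = l + k' then coeff P k' * c k else 0)"
      by (rule sum.swap)
    also have "\<dots> = (\<Sum>k\<le>degree P. coeff P k * c (l + k))"
      using elim by (intro sum.cong refl) (simp add: sum.delta)
    finally show ?case .
  qed
  have "contour_integral (circlepath 0 1)
      (\<lambda>z. \<Sum>k. h z * (c k * z powi (- int k - 1))) = (\<Sum>k\<le>degree P. coeff P k * c (l + k))"
    by (rule LIMSEQ_unique[OF L tendsto_eventually[OF ev]])
  also have "contour_integral (circlepath 0 1) (\<lambda>z. \<Sum>k. h z * (c k * z powi (- int k - 1))) =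
    contour_integral (circlepath 0 1)
           (\<lambda>z. z ^ l * poly P z * (\<Sum>k. c k * z powi (- int k - 1)) / (2 * of_real pi * \<i>))"
  proof (rule contour_integral_eq)
    fix z :: complex
    assume "z \<in> path_image (circlepath 0 1)"
    then have "summable (\<lambda>k. c k * z powi (- int k - 1))"
      using c by (intro summable_norm_cancel[OF summable_comparison_test'[OF c]])
        (auto simp: norm_mult norm_power_int)
    then show "(\<Sum>k. h z * (c k * z powi (- int k - 1))) =
        z ^ l * poly P z * (\<Sum>k. c k * z powi (- int k - 1)) / (2 * of_real pi * \<i>)"
      by (subst suminf_mult) (auto simp: h_def)
  qed
  finally show ?thesis .
qed

text \<open>Pairing each of the \<open>r\<close> upper factors with a lower one gives quotients
  tending to 1. The \<open>q - r\<close> lower factors left over tend to infinity, and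
  \<open>r < q\<close> guarantees at least one of them.\<close>

lemma tendsto_prod_linear_quotient:
  fixes \<alpha> \<beta> :: "nat \<Rightarrow> complex"
  assumes "r < q"
  shows "(\<lambda>k. (\<Prod>\<rho>=1..r. of_nat k + \<alpha> \<rho>) / (\<Prod>h=1..q. of_nat k + \<beta> h)) \<longlonglongrightarrow> 0"
proof -
  have one: "(\<lambda>k. (of_nat k + x) / (of_nat k + y)) \<longlonglongrightarrow> 1" for x y :: complex
  proof -
    have "(\<lambda>k. (1 + x / of_nat k) / (1 + y / of_nat k)) \<longlonglongrightarrow> (1 + 0) / (1 + 0)"
      by (intro tendsto_intros lim_const_over_n) auto
    moreover have "eventually (\<lambda>k. (1 + x / of_nat k) / (1 + y / of_nat k) =
        (of_nat k + x) / (of_nat k + y)) sequentially"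
      using eventually_gt_at_top[of 0] by eventually_elim (auto simp: divide_simps)
    ultimately show ?thesis
      by (simp add: filterlim_cong[OF refl refl])
  qed
  have zero: "(\<lambda>k. 1 / (of_nat k + y)) \<longlonglongrightarrow> 0" for y :: complex
    by (rule tendsto_divide_0[OF tendsto_const
          tendsto_add_filterlim_at_infinity'[OF tendsto_of_nat tendsto_const]])
  have "(\<lambda>k. (\<Prod>\<rho>=1..r. (of_nat k + \<alpha> \<rho>) / (of_nat k + \<beta> \<rho>)) *
      (\<Prod>h=Suc r..q. 1 / (of_nat k + \<beta> h))) \<longlonglongrightarrow> (\<Prod>\<rho>=1..r. 1) * (\<Prod>h=Suc r..q. 0)"
    by (intro tendsto_mult tendsto_prod one zero)
  also have "(\<lambda>k. (\<Prod>\<rho>=1..r. (of_nat k + \<alpha> \<rho>) / (of_nat k + \<beta> \<rho>)) *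
      (\<Prod>h=Suc r..q. 1 / (of_nat k + \<beta> h))) =
      (\<lambda>k. (\<Prod>\<rho>=1..r. of_nat k + \<alpha> \<rho>) / (\<Prod>h=1..q. of_nat k + \<beta> h))"
  proof
    fix k
    have "{1..q} = {1..r} \<union> {Suc r..q}" using assms by auto
    then have "(\<Prod>h=1..q. of_nat k + \<beta> h) =
        (\<Prod>h=1..r. of_nat k + \<beta> h) * (\<Prod>h=Suc r..q. of_nat k + \<beta> h)"
      by (simp add: prod.union_disjoint)
    then show "(\<Prod>\<rho>=1..r. (of_nat k + \<alpha> \<rho>) / (of_nat k + \<beta> \<rho>)) *
      (\<Prod>h=Suc r..q. 1 / (of_nat k + \<beta> h)) =
      (\<Prod>\<rho>=1..r. of_nat k + \<alpha> \<rho>) / (\<Prod>h=1..q. of_nat k + \<beta> h)"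
      by (simp add: prod_dividef)
  qed
  finally show ?thesis
    using assms by (simp add: power_0_left)
qed

text \<open>Ratio test: by the functional equation of Gamma the ratio of successive terms is the
  quotient of linear factors that tends to 0. The pole conditions make that equation valid at every
  index.\<close>

lemma summable_norm_Gamma_quotient:
  fixes \<alpha> \<beta> :: "nat \<Rightarrow> complex"
  assumes "r < q" and \<alpha>: "\<And>\<rho>. \<rho> \<in> {1..r} \<Longrightarrow> \<alpha> \<rho> \<notin> \<int>\<^sub>\<le>\<^sub>0"
    and \<beta>: "\<And>h. h \<in> {1..q} \<Longrightarrow> \<beta> h \<notin> \<int>\<^sub>\<le>\<^sub>0"
  shows "summable (\<lambda>k. norm ((\<Prod>\<rho>=1..r. Gamma (of_nat k + \<alpha> \<rho>)) / (\<Prod>h=1..q. Gamma (of_nat k + \<beta> h))))"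
    (is "summable (\<lambda>k. norm (?c k))")
proof -
  have np: "of_nat k + x \<notin> \<int>\<^sub>\<le>\<^sub>0" if "x \<notin> \<int>\<^sub>\<le>\<^sub>0" for k and x :: complex
    using that nonpos_Ints_diff_Nats[of "of_nat k + x" "of_nat k"] by auto
  have step: "?c (Suc k) = ((\<Prod>\<rho>=1..r. of_nat k + \<alpha> \<rho>) / (\<Prod>h=1..q. of_nat k + \<beta> h)) * ?c k" for k
  proof -
    have G: "Gamma (of_nat (Suc k) + x) = (of_nat k + x) * Gamma (of_nat k + x)"
      if "x \<notin> \<int>\<^sub>\<le>\<^sub>0" for x :: complex
      using Gamma_plus1[OF np[OF that], of k] by (simp add: algebra_simps)
    have "(\<Prod>\<rho>=1..r. Gamma (of_nat (Suc k) + \<alpha> \<rho>)) =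
        (\<Prod>\<rho>=1..r. of_nat k + \<alpha> \<rho>) * (\<Prod>\<rho>=1..r. Gamma (of_nat k + \<alpha> \<rho>))"
      unfolding prod.distrib[symmetric] by (intro prod.cong refl G \<alpha>)
    moreover have "(\<Prod>h=1..q. Gamma (of_nat (Suc k) + \<beta> h)) =
        (\<Prod>h=1..q. of_nat k + \<beta> h) * (\<Prod>h=1..q. Gamma (of_nat k + \<beta> h))"
      unfolding prod.distrib[symmetric] by (intro prod.cong refl G \<beta>)
    ultimately show ?thesis by simp
  qed
  have "eventually (\<lambda>k. norm ((\<Prod>\<rho>=1..r. of_nat k + \<alpha> \<rho>) / (\<Prod>h=1..q. of_nat k + \<beta> h)) < 1 / 2) sequentially"
    using tendsto_norm[OF tendsto_prod_linear_quotient[OF \<open>r < q\<close>, of \<alpha> \<beta>]]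
    by (rule order_tendstoD(2)) simp
  then obtain N where N: "\<And>k. k \<ge> N \<Longrightarrow>
      norm ((\<Prod>\<rho>=1..r. of_nat k + \<alpha> \<rho>) / (\<Prod>h=1..q. of_nat k + \<beta> h)) < 1 / 2"
    by (auto simp: eventually_sequentially)
  show ?thesis
  proof (rule summable_ratio_test[where c = "1 / 2" and N = N])
    fix k assume "N \<le> k"
    then have "norm (?c (Suc k)) \<le> 1 / 2 * norm (?c k)"
      unfolding step norm_mult using N[of k] by (intro mult_right_mono) auto
    then show "norm (norm (?c (Suc k))) \<le> 1 / 2 * norm (norm (?c k))"
      by (simp only: real_norm_def abs_norm_cancel)
  qed simp
qed

subsection \<open>Linear systems and polynomials\<close>

text \<open>Gaussian elimination: an unknown \<open>t0\<close> occurring in equation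
  \<open>i\<close> is eliminated from the other equations, which leaves one equation and one unknown
  fewer.\<close>

lemma homogeneous_system_nontrivial:
  fixes f :: "'a \<Rightarrow> 'b \<Rightarrow> 'c :: field"
  assumes "finite I" "finite X" "card I < card X"
  shows "\<exists>x. (\<exists>t\<in>X. x t \<noteq> 0) \<and> (\<forall>i\<in>I. (\<Sum>t\<in>X. f i t * x t) = 0)"
  using assms
proof (induction I arbitrary: X f rule: finite_induct)
  case empty
  then obtain t where "t \<in> X" by fastforce
  then show ?case by (intro exI[of _ "\<lambda>_. 1"]) auto
next
  case (insert i I)
  show ?case
  proof (cases "\<forall>t\<in>X. f i t = 0")
    case True
    with insert.IH[of X f] insert.prems insert.hyps show ?thesis
      by (auto simp: card_insert_if)
  next
    case False
    then obtain t0 where t0: "t0 \<in> X" "f i t0 \<noteq> 0" by blast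
    have "card I < card (X - {t0})"
      using insert t0 by auto
    then obtain x where x: "\<exists>t\<in>X - {t0}. x t \<noteq> 0"
      "\<And>i'. i' \<in> I \<Longrightarrow> (\<Sum>t\<in>X - {t0}. (f i' t - f i' t0 * f i t / f i t0) * x t) = 0"
      using insert.IH[of "X - {t0}" "\<lambda>i' t. f i' t - f i' t0 * f i t / f i t0"] insert.prems by auto
    \<comment> \<open>The pivot value is the one that equation \<open>i\<close> dictates once the
      other unknowns are known.\<close>
    define y where "y = x(t0 := - (\<Sum>t\<in>X - {t0}. f i t * x t) / f i t0)"
    have split: "(\<Sum>t\<in>X. f i' t * y t) =
        (\<Sum>t\<in>X - {t0}. f i' t * x t) - f i' t0 * (\<Sum>t\<in>X - {t0}. f i t * x t) / f i t0" for i'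
    proof -
      have "(\<Sum>t\<in>X. f i' t * y t) = f i' t0 * y t0 + (\<Sum>t\<in>X - {t0}. f i' t * y t)"
        using insert.prems t0 by (simp add: sum.remove)
      also have "(\<Sum>t\<in>X - {t0}. f i' t * y t) = (\<Sum>t\<in>X - {t0}. f i' t * x t)"
        by (intro sum.cong) (auto simp: y_def)
      finally show ?thesis by (simp add: y_def)
    qed
    have "(\<Sum>t\<in>X. f i' t * y t) = 0" if "i' \<in> insert i I" for i'
    proof (cases "i' = i")
      case True
      then show ?thesis using t0 by (simp add: split)
    next
      case False
      with that x(2)[of i'] show ?thesis
        unfolding split sum_distrib_left sum_divide_distrib sum_subtractf[symmetric]
        by (simp add: algebra_simps)
    qed
    moreover have "\<exists>t\<in>X. y t \<noteq> 0"
      using x(1) by (auto simp: y_def)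
    ultimately show ?thesis by blast
  qed
qed

lemma poly_pochhammer: "poly (pochhammer P k) x = pochhammer (poly P x) k"
  by (simp add: pochhammer_prod poly_prod)

lemma degree_pochhammer_linear:
  fixes c d :: "'a :: idom"
  shows "degree (pochhammer [:c, d:] k) \<le> k"
proof -
  have "degree (\<Prod>i=0..<k. [:c, d:] + of_nat i) \<le> (\<Sum>i=0..<k. degree ([:c, d:] + of_nat i))"
    using degree_prod_sum_le[of "{0..<k}" "\<lambda>i. [:c, d:] + of_nat i"] by (simp add: o_def)
  also have "\<dots> \<le> (\<Sum>i=0..<k. 1)"
    by (intro sum_mono degree_add_le) auto
  finally show ?thesis
    by (simp add: pochhammer_prod)
qed

lemma degree_prod_le_sum:
  assumes "finite S" "\<And>i. i \<in> S \<Longrightarrow> degree (f i) \<le> g i"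
  shows "degree (prod f S) \<le> sum g S"
  using degree_prod_sum_le[OF assms(1), of f] sum_mono[of S "degree \<circ> f" g] assms(2) by force

lemma pochhammer_neg_of_nat_eq_0: "k < N \<Longrightarrow> pochhammer (- of_nat k :: 'a :: field_char_0) N = 0"
  by (auto simp: pochhammer_eq_0_iff)

lemma pochhammer_nonzero_iff:
  "pochhammer (x :: 'a :: field_char_0) N \<noteq> 0 \<longleftrightarrow> (\<forall>k<N. x + of_nat k \<noteq> 0)"
  by (auto simp: pochhammer_eq_0_iff eq_neg_iff_add_eq_0)

text \<open>Puts the reciprocal Gamma values at all shifts \<open>u \<le> N\<close> over one
  denominator independent of \<open>u\<close>; the shift survives only in a polynomial numerator.
  This turns quotients of Gamma values into values of polynomials.\<close>

lemma inverse_Gamma_shift: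
  fixes x :: complex
  assumes "x \<notin> \<int>\<^sub>\<le>\<^sub>0" "u \<le> N"
  shows "1 / Gamma (x + of_nat u) = pochhammer (x + of_nat u) (N - u) / (pochhammer x N * Gamma x)"
proof -
  have "pochhammer x u \<noteq> 0"
    using assms(1) by (auto simp: pochhammer_eq_0_iff)
  moreover have "x + of_nat u \<notin> \<int>\<^sub>\<le>\<^sub>0"
    using assms(1) nonpos_Ints_diff_Nats[of "x + of_nat u" "of_nat u"] by auto
  moreover have "x + of_nat N \<notin> \<int>\<^sub>\<le>\<^sub>0"
    using assms(1) nonpos_Ints_diff_Nats[of "x + of_nat N" "of_nat N"] by auto
  ultimately show ?thesis
    using assms by (simp add: pochhammer_Gamma Gamma_eq_zero_iff field_simps of_nat_diff)
qed

text \<open>For \<open>N = 0\<close> the bound is -1 and admits only the zero polynomial, so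
  components with \<open>m j = 0\<close> need no separate treatment.\<close>

lemma deg_le_iff_coeff: "deg f \<le> ereal (real N - 1) \<longleftrightarrow> (\<forall>k\<ge>N. coeff f k = 0)"
proof (cases "f = 0")
  case False
  have "deg f \<le> ereal (real N - 1) \<longleftrightarrow> degree f < N"
    using False by (auto simp: deg_def)
  also have "\<dots> \<longleftrightarrow> (\<forall>k\<ge>N. coeff f k = 0)"
    using False coeff_eq_0[of f] leading_coeff_0_iff[of f] by (meson leI less_le_trans)
  finally show ?thesis .
qed (simp add: deg_def)

lemma deg_less_iff_coeff:
  assumes "deg f \<le> ereal (real N - 1)" "N \<ge> 1"
  shows "deg f < ereal (real N - 1) \<longleftrightarrow> coeff f (N - 1) = 0"
proof (cases "f = 0")
  case False
  then have "degree f \<le> N - 1"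
    using assms by (auto simp: deg_def)
  moreover have "deg f < ereal (real N - 1) \<longleftrightarrow> degree f < N - 1"
    using False assms by (auto simp: deg_def)
  ultimately show ?thesis
    using False coeff_eq_0[of f "N - 1"] leading_coeff_0_iff[of f] by (metis le_neq_implies_less)
qed (simp add: deg_def)

lemma poly_eq_0_of_roots:
  fixes f :: "'a :: idom poly"
  assumes "finite N" "\<And>x. x \<in> N \<Longrightarrow> poly f x = 0" "degree f < card N"
  shows "f = 0"
proof (rule ccontr)
  assume "f \<noteq> 0"
  then have "card N \<le> card {x. poly f x = 0}"
    using assms by (intro card_mono poly_roots_finite) auto
  also have "\<dots> \<le> degree f"
    using \<open>f \<noteq> 0\<close> by (rule card_poly_roots_bound)
  finally show False
    using assms by simp
qed

lemma near_diagonal_max_index: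
  assumes "near_diagonal q m" "j \<in> {1..q}"
  shows "m j = max_index q m \<or> Suc (m j) = max_index q m"
proof -
  have "max_index q m \<in> m ` {1..q}"
    using assms unfolding max_index_def by (intro Max_in) auto
  then obtain h where h: "h \<in> {1..q}" "max_index q m = m h" by blast
  moreover have "m j \<le> max_index q m"
    using assms unfolding max_index_def by (intro Max_ge) auto
  moreover have "\<bar>int (m j) - int (m h)\<bar> \<le> 1"
    using assms h by (auto simp: near_diagonal_def)
  ultimately show ?thesis by auto
qed

subsection \<open>Orthogonality as interpolation\<close>

locale parameter_point =
  fixes p q r :: nat and n m :: "nat \<Rightarrow> nat" and a b \<kappa> :: "nat \<Rightarrow> complex"
  assumes rq: "r < q"
    and sum_m: "(\<Sum>j=1..q. m j) = (\<Sum>i=1..p. n i) + 1"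
    and near: "near_diagonal q m"
    and dom: "(a, b, \<kappa>) \<in> param_domain p q r m"
begin

section \<open>Consequences of near-diagonality, regularity and admissibility\<close>

abbreviation M :: nat where "M \<equiv> max_index q m"

lemma m_cases: "j \<in> {1..q} \<Longrightarrow> m j = M \<or> Suc (m j) = M"
  by (rule near_diagonal_max_index[OF near])

lemma M_pos: "M \<ge> 1"
proof (rule ccontr)
  assume "\<not> M \<ge> 1"
  then have "\<And>j. j \<in> {1..q} \<Longrightarrow> m j = 0" using m_cases by fastforce
  then show False using sum_m by simp
qed

text \<open>Near-diagonality gives \<open>m h \<ge> m j - 1 \<ge> k\<close>. This keeps the
  subtractions \<open>m h - k\<close> in \<open>numer\<close> exact.\<close>

lemma index_le_m: "j \<in> {1..q} \<Longrightarrow> h \<in> {1..q} \<Longrightarrow> k < m j \<Longrightarrow> k \<le> m h"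
  using m_cases[of j] m_cases[of h] by auto

lemma J_plus_iff: "H \<in> J_plus q m \<longleftrightarrow> H \<in> {1..q} \<and> m H = M"
  by (auto simp: J_plus_def)

lemma J_minus_iff: "j \<in> J_minus q m \<longleftrightarrow> j \<in> {1..q} \<and> Suc (m j) = M \<and> m j \<ge> 1"
  by (auto simp: J_minus_def)

lemma finite_J_plus [simp]: "finite (J_plus q m)"
  by (simp add: J_plus_def)

lemma J_plus_nonempty: "J_plus q m \<noteq> {}"
proof -
  have "max_index q m \<in> m ` {1..q}"
    using rq unfolding max_index_def by (intro Max_in) auto
  then show ?thesis by (auto simp: J_plus_def)
qed

lemma b_diff:
  assumes "j \<in> {1..q}" "h \<in> {1..q}" "j \<noteq> h" "x \<in> \<int>"
  shows "b j - b h + x \<noteq> 0"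
proof
  assume "b j - b h + x = 0"
  then have "b j - b h = - x" by (simp add: eq_neg_iff_add_eq_0)
  with assms(4) have "b j - b h \<in> \<int>" by simp
  with assms dom show False by (auto simp: param_domain_def regular_def)
qed

lemma kappa_inj:
  assumes "i \<in> {1..p}" "i' \<in> {1..p}" "\<kappa> i + of_nat l = \<kappa> i' + of_nat l'"
  shows "i = i' \<and> l = l'"
proof -
  have "\<kappa> i - \<kappa> i' = of_nat l' - of_nat l" using assms(3) by (simp add: algebra_simps)
  then have "\<kappa> i - \<kappa> i' \<in> \<int>" by simp
  then have "i = i'" using assms(1,2) dom unfolding param_domain_def regular_def by blast
  with assms(3) show ?thesis by simp
qed

lemma kappa_a: "i \<in> {1..p} \<Longrightarrow> \<rho> \<in> {1..r} \<Longrightarrow> \<kappa> i + of_nat l + a \<rho> + 1 \<notin> \<int>\<^sub>\<le>\<^sub>0"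
  using dom nonpos_Ints_diff_Nats[of "\<kappa> i + of_nat l + a \<rho> + 1" "of_nat l"]
  by (auto simp: param_domain_def admissible_def algebra_simps)

lemma kappa_b: "i \<in> {1..p} \<Longrightarrow> j \<in> {1..q} \<Longrightarrow> \<kappa> i + of_nat l + b j + 1 \<notin> \<int>\<^sub>\<le>\<^sub>0"
  using dom nonpos_Ints_diff_Nats[of "\<kappa> i + of_nat l + b j + 1" "of_nat l"]
  by (auto simp: param_domain_def admissible_def algebra_simps)

text \<open>A vanishing factor would make \<open>a \<rho> - b j\<close> the integer
  \<open>K - t\<close>, between 1 and \<open>m j - 1\<close>, and the third admissibility condition
  excludes such values.\<close>

lemma a_b:
  assumes "\<rho> \<in> {1..r}" "j \<in> {1..q}" "K < m j"
  shows "pochhammer (a \<rho> - b j - of_nat K) K \<noteq> 0"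
  unfolding pochhammer_nonzero_iff
proof (intro allI impI notI)
  fix t assume t: "t < K" and eq: "a \<rho> - b j - of_nat K + of_nat t = 0"
  then have "a \<rho> - b j = of_nat K - of_nat t" by (simp add: algebra_simps)
  then have "a \<rho> - b j - of_nat (m j) + 1 = - of_nat (m j - Suc (K - t))"
    using t assms(3) by (simp add: of_nat_diff algebra_simps)
  then have "a \<rho> - b j - of_nat (m j) + 1 \<in> \<int>\<^sub>\<le>\<^sub>0" by (simp only: minus_of_nat_in_nonpos_Ints)
  moreover have "m j \<ge> 1" using assms by simp
  ultimately show False using dom assms by (auto simp: param_domain_def admissible_def)
qed

text \<open>
  With \<open>s = \<kappa> i + l\<close>, the moment at \<open>l + k\<close> of the weight with indices \<open>j\<close>, \<open>i\<close> is
  \<open>numer j k\<close> at \<open>s\<close> times a factor that depends on \<open>s\<close> only (\<open>moment_eq\<close>).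
\<close>

definition numer :: "nat \<Rightarrow> nat \<Rightarrow> complex poly" where
  "numer j k = (\<Prod>\<rho>=1..r. pochhammer [:a \<rho> + 1, 1:] k) *
     (\<Prod>h=1..q. pochhammer [:b h + 1 + of_nat (if h = j then Suc k else k), 1:]
                  (m h - (if h = j then Suc k else k)))"

lemma poly_numer:
  "poly (numer j k) s = (\<Prod>\<rho>=1..r. pochhammer (a \<rho> + 1 + s) k) *
     (\<Prod>h=1..q. pochhammer (b h + 1 + of_nat (if h = j then Suc k else k) + s)
                  (m h - (if h = j then Suc k else k)))"
  by (simp add: numer_def poly_prod poly_pochhammer)

definition combination :: "(nat \<Rightarrow> complex poly) \<Rightarrow> complex poly" where
  "combination B = (\<Sum>j=1..q. \<Sum>k<m j. smult (coeff (B j) k) (numer j k))"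

text \<open>The coefficient of \<open>z powi (- int k - 1)\<close> in the weight with indices
  \<open>j\<close>, \<open>i\<close>.\<close>

definition moment :: "nat \<Rightarrow> nat \<Rightarrow> nat \<Rightarrow> complex" where
  "moment j i k = (\<Prod>\<rho>=1..r. Gamma (of_nat k + \<kappa> i + a \<rho> + 1)) /
          (\<Prod>h=1..q. Gamma (of_nat k + \<kappa> i + b h + (if h = j then 1 else 0) + 1))"

definition nodes :: "complex set" where
  "nodes = (\<lambda>(i, l). \<kappa> i + of_nat l) ` (SIGMA i:{1..p}. {..<n i})"

lemma finite_nodes [simp]: "finite nodes"
  by (simp add: nodes_def)

text \<open>Regularity of \<open>\<kappa>\<close> separates nodes with different \<open>i\<close>,
  so counting roots needs no multiplicities.\<close>

lemma card_nodes: "card nodes = (\<Sum>i=1..p. n i)"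
proof -
  have "inj_on (\<lambda>(i, l). \<kappa> i + of_nat l) (SIGMA i:{1..p}. {..<n i})"
  proof (rule inj_onI)
    fix u v
    assume "u \<in> (SIGMA i:{1..p}. {..<n i})" "v \<in> (SIGMA i:{1..p}. {..<n i})"
      "(case u of (i, l) \<Rightarrow> \<kappa> i + of_nat l) = (case v of (i, l) \<Rightarrow> \<kappa> i + of_nat l)"
    then show "u = v"
      using kappa_inj[of "fst u" "fst v" "snd u" "snd v"] by (auto simp: case_prod_unfold prod_eq_iff)
  qed
  then show ?thesis by (simp add: nodes_def card_image)
qed

text \<open>Equality would give \<open>\<kappa> i + of_nat l + b j + 1 = - of_nat K\<close>,
  contrary to admissibility. Hence an evaluation point of the triangular scheme always comes in
  addition to the nodes.\<close>

lemma node_b: "x \<in> nodes \<Longrightarrow> j \<in> {1..q} \<Longrightarrow> x \<noteq> - b j - of_nat K - 1"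
proof
  assume x: "x \<in> nodes" and j: "j \<in> {1..q}" and eq: "x = - b j - of_nat K - 1"
  from x obtain i l where "i \<in> {1..p}" and il: "x = \<kappa> i + of_nat l" by (auto simp: nodes_def)
  then have "\<kappa> i + of_nat l + b j + 1 \<notin> \<int>\<^sub>\<le>\<^sub>0" using kappa_b j by blast
  moreover have "\<kappa> i + of_nat l + b j + 1 = - of_nat K"
    unfolding il[symmetric] eq by simp
  ultimately show False by simp
qed

lemma moment_eq:
  fixes l :: nat
  assumes i: "i \<in> {1..p}" and j: "j \<in> {1..q}" and k: "k < m j"
  defines "s \<equiv> \<kappa> i + of_nat l"
  shows "moment j i (l + k) = (\<Prod>\<rho>=1..r. Gamma (s + a \<rho> + 1)) /
     (\<Prod>h=1..q. pochhammer (s + b h + 1) (m h) * Gamma (s + b h + 1)) * poly (numer j k) s"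
proof -
  have A: "Gamma (of_nat (l + k) + \<kappa> i + a \<rho> + 1) = pochhammer (a \<rho> + 1 + s) k * Gamma (s + a \<rho> + 1)"
    if "\<rho> \<in> {1..r}" for \<rho>
    using pochhammer_Gamma[of "s + a \<rho> + 1" k] kappa_a[OF i that, of l]
    by (simp add: s_def Gamma_eq_zero_iff add_ac)
  \<comment> \<open>\<open>inverse_Gamma_shift\<close> is used with \<open>N = m h\<close>. The
    shift is \<open>k\<close>, and one more at \<open>h = j\<close> because of the unit vector in
    the weights.\<close>
  have B: "1 / Gamma (of_nat (l + k) + \<kappa> i + b h + (if h = j then 1 else 0) + 1) =
      pochhammer (b h + 1 + of_nat (if h = j then Suc k else k) + s) (m h - (if h = j then Suc k else k)) /
        (pochhammer (s + b h + 1) (m h) * Gamma (s + b h + 1))"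
    if "h \<in> {1..q}" for h
  proof -
    have "(if h = j then Suc k else k) \<le> m h"
      using index_le_m[OF j that k] k by auto
    moreover have "of_nat (l + k) + \<kappa> i + b h + (if h = j then 1 else 0) + 1 =
        s + b h + 1 + of_nat (if h = j then Suc k else k)"
      by (simp add: s_def)
    moreover have "b h + 1 + of_nat (if h = j then Suc k else k) + s =
        s + b h + 1 + of_nat (if h = j then Suc k else k)"
      by simp
    ultimately show ?thesis
      using inverse_Gamma_shift[of "s + b h + 1" "if h = j then Suc k else k" "m h"]
        kappa_b[OF i that, of l] by (simp only: s_def not_False_eq_True)
  qed
  have "moment j i (l + k) = (\<Prod>\<rho>=1..r. Gamma (of_nat (l + k) + \<kappa> i + a \<rho> + 1)) *
      (\<Prod>h=1..q. 1 / Gamma (of_nat (l + k) + \<kappa> i + b h + (if h = j then 1 else 0) + 1))"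
    by (simp add: moment_def prod_dividef)
  also have "\<dots> = (\<Prod>\<rho>=1..r. pochhammer (a \<rho> + 1 + s) k * Gamma (s + a \<rho> + 1)) *
      (\<Prod>h=1..q. pochhammer (b h + 1 + of_nat (if h = j then Suc k else k) + s)
          (m h - (if h = j then Suc k else k)) / (pochhammer (s + b h + 1) (m h) * Gamma (s + b h + 1)))"
    by (intro arg_cong2[where f = "(*)"] prod.cong refl A B)
  also have "\<dots> = (\<Prod>\<rho>=1..r. Gamma (s + a \<rho> + 1)) /
     (\<Prod>h=1..q. pochhammer (s + b h + 1) (m h) * Gamma (s + b h + 1)) * poly (numer j k) s"
    by (simp add: poly_numer prod.distrib prod_dividef mult_ac)
  finally show ?thesis .
qed

section \<open>Degrees and triangular zero pattern of the basis polynomials\<close>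

lemma degree_numer:
  assumes j: "j \<in> {1..q}" and k: "k < m j"
  shows "degree (numer j k) \<le> (\<Sum>i=1..p. n i)"
proof -
  have "degree (numer j k) \<le> r * k + (\<Sum>h=1..q. m h - (if h = j then Suc k else k))"
  proof -
    have "degree (\<Prod>\<rho>=1..r. pochhammer [:a \<rho> + 1, 1:] k) \<le> (\<Sum>\<rho>=1..r. k)"
      by (intro degree_prod_le_sum degree_pochhammer_linear) auto
    moreover have "degree (\<Prod>h=1..q. pochhammer
        [:b h + 1 + of_nat (if h = j then Suc k else k), 1:] (m h - (if h = j then Suc k else k))) \<le>
        (\<Sum>h=1..q. m h - (if h = j then Suc k else k))"
      by (intro degree_prod_le_sum degree_pochhammer_linear) auto
    ultimately show ?thesis
      unfolding numer_def by (intro order_trans[OF degree_mult_le] add_mono) simp_all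
  qed
  \<comment> \<open>The differences are exact here, so the factors with \<open>b\<close> contribute
    degree |m| - q k - 1 = |n| - q k. As \<open>r < q\<close>, the r k from the factors with
    \<open>a\<close> does not push the total above |n|.\<close>
  moreover have "(\<Sum>h=1..q. m h - (if h = j then Suc k else k)) + (q * k + 1) = (\<Sum>h=1..q. m h)"
  proof -
    have "(\<Sum>h=1..q. m h) =
        (\<Sum>h=1..q. (m h - (if h = j then Suc k else k)) + (k + (if h = j then 1 else 0)))"
      using index_le_m[OF j _ k] k by (intro sum.cong) auto
    also have "\<dots> = (\<Sum>h=1..q. m h - (if h = j then Suc k else k)) + (q * k + 1)"
      using j by (simp add: sum.distrib sum.delta)
    finally show ?thesis by simp
  qed
  moreover have "r * k \<le> q * k" using rq by (intro mult_right_mono) auto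
  ultimately show ?thesis using sum_m by linarith
qed

lemma degree_combination: "degree (combination B) \<le> (\<Sum>i=1..p. n i)"
  unfolding combination_def
  by (intro degree_sum_le order_trans[OF degree_smult_le] degree_numer) auto

text \<open>With \<open>u\<close> equal to \<open>k\<close> or, for \<open>J = j\<close>, to
  \<open>k + 1\<close>, the factor at \<open>h = J\<close> is a Pochhammer symbol starting at
  \<open>- (K - u)\<close> of length \<open>m J - u > K - u\<close>, so it runs through 0. Excluding
  \<open>(J, K)\<close> ensures \<open>u \<le> K\<close>.\<close>

lemma numer_eq_0:
  assumes j: "j \<in> {1..q}" and "k < m j" and J: "J \<in> {1..q}" and K: "K < m J"
    and "k \<le> K" "(j, k) \<noteq> (J, K)"
  shows "poly (numer j k) (- b J - of_nat K - 1) = 0"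
proof -
  define u where "u = (if J = j then Suc k else k)"
  have u: "u \<le> K" using assms by (auto simp: u_def)
  have "pochhammer (- of_nat (K - u) :: complex) (m J - u) = 0"
    using u K by (intro pochhammer_neg_of_nat_eq_0) auto
  moreover have "b J + 1 + of_nat u + (- b J - of_nat K - 1) = - of_nat (K - u)"
    using u by (simp add: of_nat_diff)
  ultimately have "\<exists>h\<in>{1..q}. poly (pochhammer [:b h + 1 + of_nat (if h = j then Suc k else k), 1:]
                  (m h - (if h = j then Suc k else k))) (- b J - of_nat K - 1) = 0"
    using J by (intro bexI[of _ J]) (simp_all add: poly_pochhammer u_def)
  then show ?thesis by (auto simp: numer_def poly_prod)
qed

text \<open>The factor at \<open>h = J\<close> is a factorial, since its Pochhammer symbol starts at
  1. The other \<open>b\<close> factors start at \<open>b h - b J\<close>, non-integral by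
  regularity, and the \<open>a\<close> factors are nonzero by admissibility.\<close>

lemma numer_nonzero:
  assumes J: "J \<in> {1..q}" and K: "K < m J"
  shows "poly (numer J K) (- b J - of_nat K - 1) \<noteq> 0"
proof -
  have A: "pochhammer (a \<rho> + 1 + (- b J - of_nat K - 1)) K \<noteq> 0" if "\<rho> \<in> {1..r}" for \<rho>
    using a_b[OF that J K] by (simp add: algebra_simps)
  have B: "pochhammer (b h + 1 + of_nat (if h = J then Suc K else K) + (- b J - of_nat K - 1))
      (m h - (if h = J then Suc K else K)) \<noteq> 0" if "h \<in> {1..q}" for h
  proof (cases "h = J")
    case True
    then show ?thesis by (simp add: pochhammer_fact[symmetric])
  next
    case False
    then show ?thesis
      using b_diff[OF that J False, of "of_nat _"] by (auto simp: pochhammer_nonzero_iff)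
  qed
  show ?thesis
    using A B by (simp add: poly_numer)
qed

text \<open>Terms with \<open>k > K\<close> vanish by assumption, those with
  \<open>k \<le> K\<close> by \<open>numer_eq_0\<close>; only the diagonal entry is left.\<close>

lemma poly_combination_top:
  assumes J: "J \<in> {1..q}" and K: "K < m J"
    and zero: "\<And>j k. j \<in> {1..q} \<Longrightarrow> k < m j \<Longrightarrow> K < k \<Longrightarrow> coeff (B j) k = 0"
  shows "poly (combination B) (- b J - of_nat K - 1) =
    coeff (B J) K * poly (numer J K) (- b J - of_nat K - 1)"
proof -
  have "poly (combination B) (- b J - of_nat K - 1) =
      (\<Sum>(j, k)\<in>(SIGMA j:{1..q}. {..<m j}). coeff (B j) k * poly (numer j k) (- b J - of_nat K - 1))"
    by (simp add: combination_def poly_sum sum.Sigma case_prod_unfold)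
  also have "\<dots> = (\<Sum>(j, k)\<in>{(J, K)}. coeff (B j) k * poly (numer j k) (- b J - of_nat K - 1))"
  proof (rule sum.mono_neutral_right)
    show "\<forall>x\<in>(SIGMA j:{1..q}. {..<m j}) - {(J, K)}. (case x of (j, k) \<Rightarrow>
        coeff (B j) k * poly (numer j k) (- b J - of_nat K - 1)) = 0"
    proof (rule ballI, unfold split_paired_all prod.case)
      fix j k assume "(j, k) \<in> (SIGMA j:{1..q}. {..<m j}) - {(J, K)}"
      then have "j \<in> {1..q}" "k < m j" "(j, k) \<noteq> (J, K)" by simp_all
      then show "coeff (B j) k * poly (numer j k) (- b J - of_nat K - 1) = 0"
        using zero[of j k] numer_eq_0[of j k J K] J K by (cases "k \<le> K") auto
    qed
  qed (use J K in auto)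
  finally show ?thesis by simp
qed

section \<open>Injectivity of the map to polynomials, and solutions as interpolants\<close>

definition bounded_vec :: "(nat \<Rightarrow> complex poly) \<Rightarrow> bool" where
  "bounded_vec B \<longleftrightarrow> (\<forall>j\<in>{1..q}. \<forall>k\<ge>m j. coeff (B j) k = 0) \<and> (\<forall>j. j \<notin> {1..q} \<longrightarrow> B j = 0)"

lemma combination_eq_0_imp:
  assumes "bounded_vec B" "combination B = 0"
  shows "B = 0"
proof -
  have coeffs: "coeff (B j) k = 0" if "j \<in> {1..q}" for j k
    using that
  \<comment> \<open>Descending induction on \<open>k\<close>: the coefficients of higher index, in
    all components, are known to vanish first.\<close>
  proof (induction "M - k" arbitrary: j k rule: less_induct)
    case less
    show ?case
    proof (cases "k < m j")
      case False
      then show ?thesis using assms less.prems by (auto simp: bounded_vec_def)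
    next
      case True
      have "coeff (B j') k' = 0" if "j' \<in> {1..q}" "k' < m j'" "k < k'" for j' k'
        using that m_cases[of j'] by (intro less.hyps) auto
      from poly_combination_top[where B = B, OF less.prems True this] numer_nonzero[OF less.prems True] assms(2)
      show ?thesis by auto
    qed
  qed
  show ?thesis
  proof
    fix j
    show "B j = 0 j"
      using coeffs[of j] assms(1) by (cases "j \<in> {1..q}") (auto simp: bounded_vec_def poly_eq_iff)
  qed
qed

lemma summable_moment:
  assumes i: "i \<in> {1..p}"
  shows "summable (\<lambda>k. norm (moment j i k))"
proof -
  have A: "\<kappa> i + a \<rho> + 1 \<notin> \<int>\<^sub>\<le>\<^sub>0" if "\<rho> \<in> {1..r}" for \<rho>
    using kappa_a[OF i that, of 0] by simp
  have B: "\<kappa> i + b h + (if h = j then 1 else 0) + 1 \<notin> \<int>\<^sub>\<le>\<^sub>0" if "h \<in> {1..q}" for h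
    using kappa_b[OF i that, of 0] kappa_b[OF i that, of 1] by (auto simp: add_ac)
  show ?thesis
    using summable_norm_Gamma_quotient[OF rq A B] by (simp only: moment_def add.assoc)
qed

text \<open>Termwise integration turns each condition into a finite sum of moments, from which
  \<open>moment_eq\<close> extracts a factor \<open>G\<close> common to all \<open>j\<close> and
  \<open>k\<close>. Admissibility keeps the Gamma and Pochhammer values in \<open>G\<close> nonzero,
  so it cancels.\<close>

lemma B_solutions_iff:
  "B \<in> B_solutions p q r n m (a, b, \<kappa>) \<longleftrightarrow>
     bounded_vec B \<and> (\<forall>x\<in>nodes. poly (combination B) x = 0)"
proof -
  have integral: "(\<Sum>j=1..q. contour_integral (circlepath 0 1)
           (\<lambda>z. z ^ l * poly (B j) z * weight q r (a, b, \<kappa>) j i z / (2 * of_real pi * \<i>))) = 0 \<longleftrightarrow>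
      poly (combination B) (\<kappa> i + of_nat l) = 0" if i: "i \<in> {1..p}" and B: "bounded_vec B" for i l
  proof -
    define s where "s = \<kappa> i + of_nat l"
    define G where "G = (\<Prod>\<rho>=1..r. Gamma (s + a \<rho> + 1)) /
      (\<Prod>h=1..q. pochhammer (s + b h + 1) (m h) * Gamma (s + b h + 1))"
    have "pochhammer (s + b h + 1) (m h) * Gamma (s + b h + 1) \<noteq> 0" if "h \<in> {1..q}" for h
      using kappa_b[OF i that, of l] by (auto simp: s_def Gamma_eq_zero_iff pochhammer_eq_0_iff)
    moreover have "Gamma (s + a \<rho> + 1) \<noteq> 0" if "\<rho> \<in> {1..r}" for \<rho>
      using kappa_a[OF i that, of l] by (simp add: s_def Gamma_eq_zero_iff)
    ultimately have "G \<noteq> 0"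
      by (simp add: G_def)
    have "(\<Sum>j=1..q. contour_integral (circlepath 0 1)
           (\<lambda>z. z ^ l * poly (B j) z * weight q r (a, b, \<kappa>) j i z / (2 * of_real pi * \<i>))) =
        (\<Sum>j=1..q. \<Sum>k\<le>degree (B j). coeff (B j) k * moment j i (l + k))"
      using contour_integral_poly_mult_Laurent[OF summable_moment[OF i]]
      by (simp add: weight_def moment_def)
    also have "\<dots> = (\<Sum>j=1..q. \<Sum>k<m j. coeff (B j) k * moment j i (l + k))"
    proof (rule sum.cong[OF refl])
      fix j assume "j \<in> {1..q}"
      then have m: "coeff (B j) k = 0" if "k \<ge> m j" for k
        using B that by (auto simp: bounded_vec_def)
      have d: "coeff (B j) k = 0" if "k > degree (B j)" for k
        using that by (rule coeff_eq_0)
      show "(\<Sum>k\<le>degree (B j). coeff (B j) k * moment j i (l + k)) =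
          (\<Sum>k<m j. coeff (B j) k * moment j i (l + k))"
        using m d by (intro sum.mono_neutral_cong) (auto simp: not_less not_le)
    qed
    also have "\<dots> = (\<Sum>j=1..q. \<Sum>k<m j. coeff (B j) k * (G * poly (numer j k) s))"
      by (intro sum.cong refl) (simp add: moment_eq[OF i] G_def s_def)
    also have "\<dots> = G * poly (combination B) s"
      by (simp add: combination_def poly_sum sum_distrib_left mult_ac)
    finally show ?thesis
      using \<open>G \<noteq> 0\<close> by (simp add: s_def)
  qed
  have bound: "bounded_vec B \<longleftrightarrow> (\<forall>j\<in>{1..q}. deg (B j) \<le> ereal (real (m j) - 1)) \<and>
      (\<forall>j. j \<notin> {1..q} \<longrightarrow> B j = 0)"
    by (simp add: bounded_vec_def deg_le_iff_coeff)
  show ?thesis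
    using integral unfolding B_solutions_def bound nodes_def by auto
qed

section \<open>Existence and uniqueness up to a scalar\<close>

lemma exists_nonzero_solution: "\<exists>B\<in>B_solutions p q r n m (a, b, \<kappa>). B \<noteq> 0"
proof -
  define X where "X = (SIGMA j:{1..q}. {..<m j})"
  \<comment> \<open>The unknowns are the |m| = |n| + 1 coefficients below the degree bounds, the
    equations the |n| vanishing conditions at the nodes.\<close>
  have "card nodes < card X"
    using sum_m by (simp add: X_def card_nodes)
  then obtain x where x: "\<exists>t\<in>X. x t \<noteq> 0"
      "\<And>s. s \<in> nodes \<Longrightarrow> (\<Sum>t\<in>X. poly (numer (fst t) (snd t)) s * x t) = 0"
    using homogeneous_system_nontrivial[of nodes X "\<lambda>s t. poly (numer (fst t) (snd t)) s"]
    by (auto simp: X_def)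
  define B where "B j = (if j \<in> {1..q} then \<Sum>k<m j. monom (x (j, k)) k else 0)" for j
  have coeff_B: "coeff (B j) k = (if k < m j then x (j, k) else 0)" if "j \<in> {1..q}" for j k
    using that by (simp add: B_def coeff_sum sum.delta)
  have "poly (combination B) s = 0" if "s \<in> nodes" for s
  proof -
    have "poly (combination B) s = (\<Sum>(j, k)\<in>X. poly (numer j k) s * x (j, k))"
      using coeff_B by (simp add: combination_def poly_sum X_def sum.Sigma[symmetric] mult_ac)
    then show ?thesis using x(2)[OF that] by (simp add: case_prod_beta)
  qed
  moreover have "bounded_vec B"
    unfolding bounded_vec_def using coeff_B by (auto simp: B_def)
  ultimately have sol: "B \<in> B_solutions p q r n m (a, b, \<kappa>)"
    unfolding B_solutions_iff by simp
  have "\<exists>j k. j \<in> {1..q} \<and> k < m j \<and> x (j, k) \<noteq> 0"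
    using x(1) by (auto simp: X_def)
  then obtain j k where "j \<in> {1..q}" "k < m j" "x (j, k) \<noteq> 0"
    by blast
  then have "B j \<noteq> 0"
    using coeff_B[of j k] by auto
  then have "B \<noteq> 0" by auto
  with sol show ?thesis by blast
qed

lemma smult_vec_apply: "smult_vec c B j = smult c (B j)"
  by (simp add: smult_vec_def)

lemma combination_add: "combination (B + B') = combination B + combination B'"
  by (simp add: combination_def smult_add_left sum.distrib)

lemma combination_smult: "combination (smult_vec c B) = smult c (combination B)"
  by (simp add: poly_eq_iff combination_def smult_vec_def coeff_sum sum_distrib_left mult_ac)

lemma subspace_B_solutions: "poly_vec.subspace (B_solutions p q r n m (a, b, \<kappa>))"
proof (rule poly_vec.subspaceI)
  show "0 \<in> B_solutions p q r n m (a, b, \<kappa>)"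
    by (simp add: B_solutions_iff bounded_vec_def combination_def)
qed (auto simp: B_solutions_iff bounded_vec_def combination_add combination_smult smult_vec_apply)

text \<open>No index exceeds \<open>M - 1\<close>, so with \<open>K = M - 1\<close> the assumption
  on higher coefficients in \<open>poly_combination_top\<close> is vacuous.\<close>

lemma poly_combination_J_plus:
  assumes "H \<in> J_plus q m"
  shows "poly (combination B) (- b H - of_nat M) =
    coeff (B H) (M - 1) * poly (numer H (M - 1)) (- b H - of_nat M)"
    and "poly (numer H (M - 1)) (- b H - of_nat M) \<noteq> 0"
proof -
  have H: "H \<in> {1..q}" "M - 1 < m H" using assms M_pos by (auto simp: J_plus_iff)
  have s: "- b H - of_nat (M - 1) - 1 = - b H - of_nat M"
    using M_pos by (simp add: of_nat_diff)
  show "poly (combination B) (- b H - of_nat M) =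
    coeff (B H) (M - 1) * poly (numer H (M - 1)) (- b H - of_nat M)"
    unfolding s[symmetric] using m_cases by (intro poly_combination_top H) fastforce
  show "poly (numer H (M - 1)) (- b H - of_nat M) \<noteq> 0"
    using numer_nonzero[OF H] unfolding s .
qed

text \<open>A zero top coefficient would make \<open>- b H - of_nat M\<close>, which is not a node,
  a further root of \<open>combination B\<close>: |n| + 1 roots against degree at most |n|.
  Injectivity then gives \<open>B = 0\<close>.\<close>

lemma top_coeff_nonzero:
  assumes B: "B \<in> B_solutions p q r n m (a, b, \<kappa>)" "B \<noteq> 0" and H: "H \<in> J_plus q m"
  shows "coeff (B H) (M - 1) \<noteq> 0"
proof
  assume "coeff (B H) (M - 1) = 0"
  then have root: "poly (combination B) (- b H - of_nat M) = 0"
    using poly_combination_J_plus[OF H] by simp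
  have new: "- b H - of_nat M \<notin> nodes"
    using node_b[of _ H "M - 1"] H M_pos by (auto simp: J_plus_iff of_nat_diff)
  have "combination B = 0"
  proof (rule poly_eq_0_of_roots[of "insert (- b H - of_nat M) nodes"])
    show "degree (combination B) < card (insert (- b H - of_nat M) nodes)"
      using new degree_combination[of B] by (simp add: card_nodes)
  qed (use root B in \<open>auto simp: B_solutions_iff\<close>)
  then show False
    using combination_eq_0_imp B by (auto simp: B_solutions_iff)
qed

text \<open>By \<open>top_coeff_nonzero\<close>, the top coefficient of one component in
  \<open>J_plus\<close> is a linear functional with trivial kernel on the solution space.\<close>

lemma dim_B_solutions: "poly_vec.dim (B_solutions p q r n m (a, b, \<kappa>)) = 1"
proof -
  obtain B where B: "B \<in> B_solutions p q r n m (a, b, \<kappa>)" "B \<noteq> 0"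
    using exists_nonzero_solution by blast
  obtain H where H: "H \<in> J_plus q m" using J_plus_nonempty by blast
  have "B_solutions p q r n m (a, b, \<kappa>) \<subseteq> poly_vec.span {B}"
  proof
    fix B' assume B': "B' \<in> B_solutions p q r n m (a, b, \<kappa>)"
    define c where "c = coeff (B' H) (M - 1) / coeff (B H) (M - 1)"
    have "B' - smult_vec c B \<in> B_solutions p q r n m (a, b, \<kappa>)"
      using B B' subspace_B_solutions
      by (intro poly_vec.subspace_diff poly_vec.subspace_scale)
    moreover have "coeff ((B' - smult_vec c B) H) (M - 1) = 0"
      using top_coeff_nonzero[OF B H] by (simp add: c_def smult_vec_def)
    ultimately have "B' - smult_vec c B = 0"
      using top_coeff_nonzero H by blast
    then show "B' \<in> poly_vec.span {B}"
      by (auto simp: poly_vec.span_singleton)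
  qed
  then show ?thesis
    using B by (intro poly_vec.dim_unique[of "{B}"]) auto
qed

text \<open>The sign makes the values at \<open>- b j - k\<close> the Pochhammer products of \<open>\<F>\<^sub>j\<close>.\<close>

definition nodal_poly :: "complex poly" where
  "nodal_poly = (\<Prod>i=1..p. pochhammer [:\<kappa> i, - 1:] (n i))"

lemma poly_nodal_poly: "poly nodal_poly s = (\<Prod>i=1..p. pochhammer (\<kappa> i - s) (n i))"
  by (simp add: nodal_poly_def poly_prod poly_pochhammer)

text \<open>Both polynomials have degree at most |n| and vanish at the |n| nodes; choosing
  \<open>c\<close> so that they agree at one more point \<open>s\<close> makes them equal.
  Injectivity gives \<open>c \<noteq> 0\<close>.\<close>

lemma combination_eq_nodal_poly:
  assumes B: "B \<in> B_solutions p q r n m (a, b, \<kappa>)" "B \<noteq> 0"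
  obtains c where "c \<noteq> 0" "combination B = smult c nodal_poly"
proof -
  obtain H where H: "H \<in> J_plus q m" using J_plus_nonempty by blast
  define s where "s = - b H - of_nat M"
  have new: "s \<notin> nodes"
    using node_b[of _ H "M - 1"] H M_pos by (auto simp: J_plus_iff of_nat_diff s_def)
  have nz: "poly nodal_poly s \<noteq> 0"
  proof -
    have "pochhammer (\<kappa> i - s) (n i) \<noteq> 0" if i: "i \<in> {1..p}" for i
      unfolding pochhammer_nonzero_iff
    proof (intro allI impI)
      fix l assume "l < n i"
      with i have "\<kappa> i + of_nat l \<in> nodes" by (force simp: nodes_def)
      with new show "\<kappa> i - s + of_nat l \<noteq> 0" by (auto simp: algebra_simps)
    qed
    then show ?thesis by (simp add: poly_nodal_poly)
  qed
  define c where "c = poly (combination B) s / poly nodal_poly s"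
  have "combination B - smult c nodal_poly = 0"
  proof (rule poly_eq_0_of_roots[of "insert s nodes"])
    have "degree nodal_poly \<le> (\<Sum>i=1..p. n i)"
      unfolding nodal_poly_def by (intro degree_prod_le_sum degree_pochhammer_linear) auto
    then have "degree (combination B - smult c nodal_poly) \<le> (\<Sum>i=1..p. n i)"
      by (intro degree_diff_le degree_combination order_trans[OF degree_smult_le])
    then show "degree (combination B - smult c nodal_poly) < card (insert s nodes)"
      using new by (simp add: card_nodes)
    show "poly (combination B - smult c nodal_poly) x = 0" if "x \<in> insert s nodes" for x
    proof (cases "x = s")
      case True
      then show ?thesis using nz by (simp add: c_def)
    next
      case False
      with that have x: "x \<in> nodes" by simp
      then obtain i l where i: "i \<in> {1..p}" and "l < n i" "x = \<kappa> i + of_nat l"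
        by (auto simp: nodes_def)
      then have "pochhammer (\<kappa> i - x) (n i) = 0"
        using pochhammer_neg_of_nat_eq_0[of l "n i"] by simp
      with i have "poly nodal_poly x = 0"
        by (auto simp: poly_nodal_poly)
      then show ?thesis using x B by (simp add: B_solutions_iff)
    qed
  qed simp
  then have "combination B = smult c nodal_poly" by simp
  moreover from this have "c \<noteq> 0"
    using B combination_eq_0_imp[of B] by (auto simp: B_solutions_iff)
  ultimately show ?thesis using that by blast
qed

section \<open>Leading coefficients of the components in \<open>J_minus\<close>\<close>

lemma poly_numer_J_plus:
  assumes "H \<in> J_plus q m"
  shows "poly (numer H (M - 1)) s =
    (\<Prod>\<rho>=1..r. pochhammer (a \<rho> + 1 + s) (M - 1)) * (\<Prod>L\<in>J_plus q m - {H}. b L + of_nat M + s)"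
proof -
  have "(\<Prod>h=1..q. pochhammer (b h + 1 + of_nat (if h = H then Suc (M - 1) else M - 1) + s)
          (m h - (if h = H then Suc (M - 1) else M - 1))) =
      (\<Prod>h=1..q. if h \<in> J_plus q m - {H} then b h + of_nat M + s else 1)"
  proof (intro prod.cong refl)
    fix h assume "h \<in> {1..q}"
    \<comment> \<open>The Pochhammer lengths are 0 at \<open>h = H\<close>, 1 elsewhere on
      \<open>J_plus\<close>, and 0 off \<open>J_plus\<close>, so only linear factors remain.\<close>
    then consider "h = H" | "h \<noteq> H" "m h = M" "h \<in> J_plus q m" | "h \<noteq> H" "m h = M - 1" "h \<notin> J_plus q m"
      using m_cases[of h] M_pos by (fastforce simp: J_plus_iff)
    then show "pochhammer (b h + 1 + of_nat (if h = H then Suc (M - 1) else M - 1) + s)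
          (m h - (if h = H then Suc (M - 1) else M - 1)) =
        (if h \<in> J_plus q m - {H} then b h + of_nat M + s else 1)"
      using assms M_pos by cases (auto simp: J_plus_iff of_nat_diff)
  qed
  also have "\<dots> = (\<Prod>L\<in>J_plus q m - {H}. b L + of_nat M + s)"
    by (intro prod.mono_neutral_cong_right) (auto simp: J_plus_iff)
  finally show ?thesis
    by (simp only: poly_numer)
qed

lemma J_plus_b_nonzero:
  assumes "j \<in> J_minus q m" "H \<in> J_plus q m"
  shows "b H - b j + 1 \<noteq> 0"
proof -
  have "H \<noteq> j" using assms by (auto simp: J_plus_iff J_minus_iff)
  then show ?thesis
    using b_diff[of H j 1] assms by (auto simp: J_plus_iff J_minus_iff)
qed

lemma pochhammer_b_nonzero:
  assumes "j \<in> {1..q}" "h \<in> {1..q} - {j}"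
  shows "pochhammer (b h - (b j + of_nat M - 2)) N \<noteq> 0"
  unfolding pochhammer_nonzero_iff
proof (intro allI impI)
  fix k
  show "b h - (b j + of_nat M - 2) + of_nat k \<noteq> 0"
    using b_diff[of h j "2 - of_nat M + of_nat k"] assms by (simp add: algebra_simps)
qed

lemma pochhammer_M_nonzero: "pochhammer (- of_nat M + 2 :: complex) (M - 2) \<noteq> 0"
  unfolding pochhammer_nonzero_iff
proof (intro allI impI)
  fix k assume "k < M - 2"
  then have "- of_nat M + 2 + of_nat k = (- of_nat (M - 2 - k) :: complex)"
    by (simp add: of_nat_diff)
  then show "- of_nat M + 2 + of_nat k \<noteq> (0 :: complex)"
    using \<open>k < M - 2\<close> by (metis neg_equal_0_iff_equal of_nat_eq_0_iff zero_less_diff less_irrefl)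
qed

text \<open>Both products are factors of \<open>numer H (M - 1)\<close> at
  \<open>- b H - of_nat M\<close>, a diagonal value of the triangular scheme and therefore
  nonzero.\<close>

lemma J_plus_denominators_nonzero:
  assumes H: "H \<in> J_plus q m"
  shows "(\<Prod>\<rho>=1..r. pochhammer (a \<rho> - b H - (of_nat M - 1)) (M - 1)) \<noteq> 0"
    and "(\<Prod>L\<in>J_plus q m - {H}. b L - b H) \<noteq> 0"
proof -
  have s: "a \<rho> + 1 + (- b H - of_nat M) = a \<rho> - b H - (of_nat M - 1)" for \<rho>
    by simp
  show "(\<Prod>\<rho>=1..r. pochhammer (a \<rho> - b H - (of_nat M - 1)) (M - 1)) \<noteq> 0"
    "(\<Prod>L\<in>J_plus q m - {H}. b L - b H) \<noteq> 0"
    using poly_combination_J_plus(2)[OF H] unfolding poly_numer_J_plus[OF H] s by auto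
qed

text \<open>One level below the top: at the point for \<open>K = M - 2\<close> the entries with
  \<open>k \<le> M - 2\<close> drop out except \<open>(j, M - 2)\<close>, while
  \<open>k = M - 1\<close> occurs only for indices in \<open>J_plus\<close>, whose terms need not
  vanish.\<close>

lemma poly_combination_J_minus:
  assumes j: "j \<in> J_minus q m"
  defines "s \<equiv> - b j - of_nat (M - 1)"
  shows "poly (combination B) s = coeff (B j) (M - 2) * poly (numer j (M - 2)) s +
      (\<Sum>H\<in>J_plus q m. coeff (B H) (M - 1) * poly (numer H (M - 1)) s)"
    and "poly (numer j (M - 2)) s \<noteq> 0"
proof -
  have M2: "M \<ge> 2" and j': "j \<in> {1..q}" "M - 2 < m j" "j \<notin> J_plus q m"
    using j by (auto simp: J_minus_iff J_plus_iff)
  have s: "s = - b j - of_nat (M - 2) - 1"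
    using M2 by (simp add: s_def of_nat_diff)
  show "poly (numer j (M - 2)) s \<noteq> 0"
    unfolding s by (rule numer_nonzero) fact+
  define S where "S = insert (j, M - 2) ((\<lambda>H. (H, M - 1)) ` J_plus q m)"
  have "poly (combination B) s =
      (\<Sum>(i, k)\<in>(SIGMA i:{1..q}. {..<m i}). coeff (B i) k * poly (numer i k) s)"
    by (simp add: combination_def poly_sum sum.Sigma case_prod_unfold)
  also have "\<dots> = (\<Sum>(i, k)\<in>S. coeff (B i) k * poly (numer i k) s)"
  proof (rule sum.mono_neutral_right)
    show "S \<subseteq> (SIGMA i:{1..q}. {..<m i})"
      using j' M2 by (auto simp: S_def J_plus_iff)
    show "\<forall>x\<in>(SIGMA i:{1..q}. {..<m i}) - S.
        (case x of (i, k) \<Rightarrow> coeff (B i) k * poly (numer i k) s) = 0"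
    proof clarify
      fix i k assume i: "i \<in> {1..q}" and k: "k < m i" and S: "(i, k) \<notin> S"
      have "k \<le> M - 2"
        using m_cases[OF i] k S i by (auto simp: S_def image_iff J_plus_iff)
      moreover have "(i, k) \<noteq> (j, M - 2)" using S by (auto simp: S_def)
      ultimately show "coeff (B i) k * poly (numer i k) s = 0"
        unfolding s using numer_eq_0[OF i k j'(1,2)] by simp
    qed
  qed simp
  also have "\<dots> = coeff (B j) (M - 2) * poly (numer j (M - 2)) s +
      (\<Sum>H\<in>J_plus q m. coeff (B H) (M - 1) * poly (numer H (M - 1)) s)"
    using j' by (subst S_def, subst sum.insert) (auto simp: sum.reindex inj_on_def)
  finally show "poly (combination B) s = \<dots>" .
qed

text \<open>The values of \<open>combination B = smult c nodal_poly\<close> at the points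
  \<open>- b H - of_nat M\<close> give the leading coefficients on \<open>J_plus\<close>. Inserting
  them into the value at \<open>- b j - of_nat (M - 1)\<close> leaves one equation for the
  coefficient of \<open>B j\<close> at \<open>M - 2\<close>, whose right-hand side is a nonzero
  multiple of \<open>F_exc\<close>.\<close>

lemma J_minus_criterion:
  assumes B: "B \<in> B_solutions p q r n m (a, b, \<kappa>)" "B \<noteq> 0" and j: "j \<in> J_minus q m"
  shows "coeff (B j) (m j - 1) = 0 \<longleftrightarrow> F_exc p q r n m j (a, b, \<kappa>) = 0"
proof -
  define J where "J = J_plus q m"
  have M2: "M \<ge> 2" "m j - 1 = M - 2" and jq: "j \<in> {1..q}"
    using j by (auto simp: J_minus_iff)
  have jJ: "j \<notin> J" using j by (auto simp: J_def J_minus_iff J_plus_iff)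
  obtain c where c: "c \<noteq> 0" "combination B = smult c nodal_poly"
    using combination_eq_nodal_poly[OF B] .
  define s where "s = - b j - of_nat (M - 1)"
  have s: "s = - b j - of_nat M + 1" using M2 by (simp add: s_def of_nat_diff)
  define w where "w H = (\<Prod>i=1..p. pochhammer (\<kappa> i + (b H + of_nat M)) (n i))" for H
  define w' where "w' = (\<Prod>i=1..p. pochhammer (\<kappa> i + (b j + of_nat M - 1)) (n i))"
  define \<alpha> where "\<alpha> H = (\<Prod>\<rho>=1..r. pochhammer (a \<rho> - b H - (of_nat M - 1)) (M - 1))" for H
  define \<alpha>' where "\<alpha>' = (\<Prod>\<rho>=1..r. pochhammer (a \<rho> - b j - (of_nat M - 2)) (M - 1))"
  define D where "D H = (\<Prod>L\<in>J - {H}. b L - b H)" for H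
  define P where "P = (\<Prod>L\<in>J. b L - b j + 1)"
  define S where "S = (\<Sum>H\<in>J. w H / (\<alpha> H * (b H - b j + 1) * D H))"
  define K where "K = pochhammer (- of_nat M + 2 :: complex) (M - 2)"
  define D1 where "D1 = (\<Prod>h\<in>{1..q} - {j}. pochhammer (b h - (b j + of_nat M - 2)) (M - 1))"
  define Dm where "Dm = (\<Prod>h\<in>{1..q} - {j}. pochhammer (b h - (b j + of_nat M - 2)) (m h))"
  have F: "F_exc p q r n m j (a, b, \<kappa>) = - (w' / (K * Dm)) + \<alpha>' / (K * D1) * S"
    by (simp add: F_exc_def Let_def w_def w'_def \<alpha>_def \<alpha>'_def D_def S_def K_def
        D1_def Dm_def J_def)
  have nz: "K \<noteq> 0" "Dm \<noteq> 0" "D1 \<noteq> 0"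
    using pochhammer_M_nonzero pochhammer_b_nonzero[OF jq] by (auto simp: K_def Dm_def D1_def)
  \<comment> \<open>For \<open>h\<close> in \<open>J\<close> the Pochhammer symbol in
    \<open>Dm\<close> has one more factor than that in \<open>D1\<close>, namely the last one,
    \<open>b h - b j + 1\<close>.\<close>
  have "Dm = (\<Prod>h\<in>{1..q} - {j}. pochhammer (b h - (b j + of_nat M - 2)) (M - 1) *
      (if h \<in> J then b h - b j + 1 else 1))"
    unfolding Dm_def
  proof (intro prod.cong refl)
    fix h assume h: "h \<in> {1..q} - {j}"
    show "pochhammer (b h - (b j + of_nat M - 2)) (m h) =
        pochhammer (b h - (b j + of_nat M - 2)) (M - 1) * (if h \<in> J then b h - b j + 1 else 1)"
    proof (cases "h \<in> J")
      case True
      then have mh: "m h = Suc (M - 1)" using M2 by (simp add: J_def J_plus_iff)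
      show ?thesis
        unfolding mh pochhammer_Suc using True M2 by (simp add: of_nat_diff)
    next
      case False
      then have "m h = M - 1" using h m_cases[of h] by (auto simp: J_def J_plus_iff)
      then show ?thesis using False by simp
    qed
  qed
  also have "\<dots> = D1 * (\<Prod>h\<in>{1..q} - {j}. if h \<in> J then b h - b j + 1 else 1)"
    by (simp add: prod.distrib D1_def)
  also have "(\<Prod>h\<in>{1..q} - {j}. if h \<in> J then b h - b j + 1 else 1) = P"
    unfolding P_def using jJ
    by (intro prod.mono_neutral_cong_right) (auto simp: J_def J_plus_iff)
  finally have Dm: "Dm = D1 * P" .
  have top: "coeff (B H) (M - 1) = c * w H / (\<alpha> H * D H)" if "H \<in> J" for H
  proof -
    have H: "H \<in> J_plus q m" using that by (simp add: J_def)
    have "poly (numer H (M - 1)) (- b H - of_nat M) = \<alpha> H * D H"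
      unfolding poly_numer_J_plus[OF H] by (simp add: \<alpha>_def D_def J_def algebra_simps)
    moreover have "poly (combination B) (- b H - of_nat M) = c * w H"
      by (simp add: c poly_nodal_poly w_def algebra_simps)
    moreover have "\<alpha> H * D H \<noteq> 0"
      using J_plus_denominators_nonzero[OF H] by (simp add: \<alpha>_def D_def J_def)
    ultimately show ?thesis
      using poly_combination_J_plus(1)[OF H, of B] by (simp add: field_simps)
  qed
  have numer_s: "poly (numer H (M - 1)) s = \<alpha>' * (P / (b H - b j + 1))" if "H \<in> J" for H
  proof -
    have H: "H \<in> J_plus q m" using that by (simp add: J_def)
    \<comment> \<open>Completing the product by its factor at \<open>H\<close> makes it independent
      of \<open>H\<close>, so it leaves the sum; the divisor \<open>b H - b j + 1\<close> is the one
      in \<open>S\<close>.\<close>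
    have "P = (b H - b j + 1) * (\<Prod>L\<in>J - {H}. b L - b j + 1)"
      unfolding P_def using that by (intro prod.remove) (auto simp: J_def)
    then have "(\<Prod>L\<in>J - {H}. b L - b j + 1) = P / (b H - b j + 1)"
      using J_plus_b_nonzero[OF j H] by simp
    then show ?thesis
      unfolding poly_numer_J_plus[OF H] s by (simp add: \<alpha>'_def J_def algebra_simps)
  qed
  have "(\<Sum>H\<in>J. coeff (B H) (M - 1) * poly (numer H (M - 1)) s) = c * \<alpha>' * P * S"
    unfolding S_def sum_distrib_left using top numer_s by (intro sum.cong) (auto simp: mult_ac)
  moreover have "poly (combination B) s = c * w'"
    by (simp add: c poly_nodal_poly w'_def s algebra_simps)
  ultimately have "coeff (B j) (M - 2) * poly (numer j (M - 2)) s = c * (w' - \<alpha>' * P * S)"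
    using poly_combination_J_minus(1)[OF j, of B] by (simp add: s_def J_def algebra_simps)
  \<comment> \<open>By \<open>Dm = D1 * P\<close> this is \<open>F_exc\<close> with its denominators
    cleared.\<close>
  also have "w' - \<alpha>' * P * S = - (K * Dm) * F_exc p q r n m j (a, b, \<kappa>)"
    unfolding F Dm using nz unfolding Dm by (simp add: field_simps)
  finally show ?thesis
    using c nz poly_combination_J_minus(2)[OF j] M2 by (auto simp: s_def)
qed

end

subsection \<open>Rational functions of the parameters\<close>

text \<open>Rational functions without poles on \<open>D\<close>: as the denominator has no zero
  there, the zero set in \<open>D\<close> is that of the numerator polynomial.\<close>

definition param_fracs :: "nat \<Rightarrow> nat \<Rightarrow> nat \<Rightarrow> params set \<Rightarrow> (params \<Rightarrow> complex) set" where
  "param_fracs p q r D = {f. \<exists>g\<in>param_polys p q r. \<exists>h\<in>param_polys p q r.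
     \<forall>x\<in>D. h x \<noteq> 0 \<and> f x = g x / h x}"

lemma param_fracsI:
  "g \<in> param_polys p q r \<Longrightarrow> h \<in> param_polys p q r \<Longrightarrow>
   (\<And>x. x \<in> D \<Longrightarrow> h x \<noteq> 0 \<and> f x = g x / h x) \<Longrightarrow> f \<in> param_fracs p q r D"
  unfolding param_fracs_def by blast

lemma param_fracs_poly: "f \<in> param_polys p q r \<Longrightarrow> f \<in> param_fracs p q r D"
  by (rule param_fracsI[OF _ param_polys.const[of 1]]) auto

lemma param_fracs_const: "(\<lambda>_. c) \<in> param_fracs p q r D"
  by (intro param_fracs_poly param_polys.const)

lemma param_fracs_coord:
  "\<rho> \<in> {1..r} \<Longrightarrow> (\<lambda>x. fst x \<rho>) \<in> param_fracs p q r D"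
  "j \<in> {1..q} \<Longrightarrow> (\<lambda>x. fst (snd x) j) \<in> param_fracs p q r D"
  "i \<in> {1..p} \<Longrightarrow> (\<lambda>x. snd (snd x) i) \<in> param_fracs p q r D"
  using param_polys.coord_a[of \<rho> r p q] param_polys.coord_b[of j q p r]
    param_polys.coord_kappa[of i p q r]
  by (auto intro!: param_fracs_poly simp: case_prod_unfold)

lemma param_fracs_add:
  assumes "f \<in> param_fracs p q r D" "g \<in> param_fracs p q r D"
  shows "(\<lambda>x. f x + g x) \<in> param_fracs p q r D"
proof -
  obtain f1 f2 g1 g2 where P: "f1 \<in> param_polys p q r" "f2 \<in> param_polys p q r"
      "g1 \<in> param_polys p q r" "g2 \<in> param_polys p q r"
    and eq: "\<And>x. x \<in> D \<Longrightarrow> f2 x \<noteq> 0 \<and> f x = f1 x / f2 x" "\<And>x. x \<in> D \<Longrightarrow> g2 x \<noteq> 0 \<and> g x = g1 x / g2 x"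
    using assms unfolding param_fracs_def by blast
  show ?thesis
    by (rule param_fracsI[OF param_polys.add[OF param_polys.mult[OF P(1,4)] param_polys.mult[OF P(3,2)]]
          param_polys.mult[OF P(2,4)]]) (use eq in \<open>auto simp: field_simps\<close>)
qed

lemma param_fracs_mult:
  assumes "f \<in> param_fracs p q r D" "g \<in> param_fracs p q r D"
  shows "(\<lambda>x. f x * g x) \<in> param_fracs p q r D"
proof -
  obtain f1 f2 g1 g2 where P: "f1 \<in> param_polys p q r" "f2 \<in> param_polys p q r"
      "g1 \<in> param_polys p q r" "g2 \<in> param_polys p q r"
    and eq: "\<And>x. x \<in> D \<Longrightarrow> f2 x \<noteq> 0 \<and> f x = f1 x / f2 x" "\<And>x. x \<in> D \<Longrightarrow> g2 x \<noteq> 0 \<and> g x = g1 x / g2 x"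
    using assms unfolding param_fracs_def by blast
  show ?thesis
    by (rule param_fracsI[OF param_polys.mult[OF P(1,3)] param_polys.mult[OF P(2,4)]])
      (use eq in auto)
qed

lemma param_fracs_divide:
  assumes "f \<in> param_fracs p q r D" "g \<in> param_fracs p q r D" "\<And>x. x \<in> D \<Longrightarrow> g x \<noteq> 0"
  shows "(\<lambda>x. f x / g x) \<in> param_fracs p q r D"
proof -
  obtain f1 f2 g1 g2 where P: "f1 \<in> param_polys p q r" "f2 \<in> param_polys p q r"
      "g1 \<in> param_polys p q r" "g2 \<in> param_polys p q r"
    and eq: "\<And>x. x \<in> D \<Longrightarrow> f2 x \<noteq> 0 \<and> f x = f1 x / f2 x" "\<And>x. x \<in> D \<Longrightarrow> g2 x \<noteq> 0 \<and> g x = g1 x / g2 x"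
    using assms unfolding param_fracs_def by blast
  show ?thesis
    by (rule param_fracsI[OF param_polys.mult[OF P(1,4)] param_polys.mult[OF P(2,3)]])
      (use eq assms(3) in force)
qed

lemma param_fracs_uminus: "f \<in> param_fracs p q r D \<Longrightarrow> (\<lambda>x. - f x) \<in> param_fracs p q r D"
  using param_fracs_mult[OF param_fracs_const[of "- 1"]] by fastforce

lemma param_fracs_diff:
  "f \<in> param_fracs p q r D \<Longrightarrow> g \<in> param_fracs p q r D \<Longrightarrow> (\<lambda>x. f x - g x) \<in> param_fracs p q r D"
  using param_fracs_add[OF _ param_fracs_uminus] by fastforce

lemma param_fracs_sum:
  "(\<And>i. i \<in> A \<Longrightarrow> f i \<in> param_fracs p q r D) \<Longrightarrow> (\<lambda>x. \<Sum>i\<in>A. f i x) \<in> param_fracs p q r D"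
  by (induction A rule: infinite_finite_induct) (auto intro: param_fracs_const param_fracs_add)

lemma param_fracs_prod:
  "(\<And>i. i \<in> A \<Longrightarrow> f i \<in> param_fracs p q r D) \<Longrightarrow> (\<lambda>x. \<Prod>i\<in>A. f i x) \<in> param_fracs p q r D"
  by (induction A rule: infinite_finite_induct) (auto intro: param_fracs_const param_fracs_mult)

lemma param_fracs_pochhammer:
  "f \<in> param_fracs p q r D \<Longrightarrow> (\<lambda>x. pochhammer (f x) N) \<in> param_fracs p q r D"
  unfolding pochhammer_prod by (intro param_fracs_prod param_fracs_add param_fracs_const)

lemmas param_fracs_intros =
  param_fracs_const param_fracs_coord param_fracs_add param_fracs_diff param_fracs_uminus
  param_fracs_mult param_fracs_divide param_fracs_sum param_fracs_prod param_fracs_pochhammer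

lemma algebraic_in_param_fracs:
  assumes "f \<in> param_fracs p q r D"
  shows "algebraic_in p q r D {x\<in>D. f x = 0}"
proof -
  obtain g h where "g \<in> param_polys p q r" "\<And>x. x \<in> D \<Longrightarrow> h x \<noteq> 0 \<and> f x = g x / h x"
    using assms unfolding param_fracs_def by blast
  then show ?thesis
    unfolding algebraic_in_def by (intro exI[of _ "{g}"]) auto
qed

text \<open>\<open>F_exc\<close> is built from the coordinates by the closure rules; regularity and
  admissibility keep every denominator nonzero on the whole domain.\<close>

lemma algebraic_exceptional_set:
  assumes rq: "r < q" and sum_m: "(\<Sum>j=1..q. m j) = (\<Sum>i=1..p. n i) + 1"
    and near: "near_diagonal q m" and j: "j \<in> J_minus q m"
  shows "algebraic_in p q r (param_domain p q r m) (exceptional_set p q r n m j)"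
proof -
  define M where "M = max_index q m"
  define A where "A x = (\<Prod>i=1..p. pochhammer (snd (snd x) i + (fst (snd x) j + of_nat M - 1)) (n i)) /
         (pochhammer (- of_nat M + 2) (M - 2) *
          (\<Prod>h\<in>{1..q} - {j}. pochhammer (fst (snd x) h - (fst (snd x) j + of_nat M - 2)) (m h)))"
    for x :: params
  define C where "C x = (\<Prod>\<rho>=1..r. pochhammer (fst x \<rho> - fst (snd x) j - (of_nat M - 2)) (M - 1)) /
        (pochhammer (- of_nat M + 2) (M - 2) *
         (\<Prod>h\<in>{1..q} - {j}. pochhammer (fst (snd x) h - (fst (snd x) j + of_nat M - 2)) (M - 1)))"
    for x :: params
  define E where "E H x = (\<Prod>i=1..p. pochhammer (snd (snd x) i + (fst (snd x) H + of_nat M)) (n i)) /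
              ((\<Prod>\<rho>=1..r. pochhammer (fst x \<rho> - fst (snd x) H - (of_nat M - 1)) (M - 1)) *
             (fst (snd x) H - fst (snd x) j + 1) *
             (\<Prod>L\<in>J_plus q m - {H}. fst (snd x) L - fst (snd x) H))"
    for H and x :: params
  have F: "F_exc p q r n m j x = - A x + C x * (\<Sum>H\<in>J_plus q m. E H x)" for x
    by (cases x) (simp add: F_exc_def Let_def A_def C_def E_def M_def)
  \<comment> \<open>Every point of the domain instantiates the locale, so its nonvanishing lemmas
    hold pointwise there.\<close>
  have pp: "parameter_point p q r n m (fst x) (fst (snd x)) (snd (snd x))"
    if "x \<in> param_domain p q r m" for x
    using assms that by unfold_locales simp_all
  have jq: "j \<in> {1..q}" using j by (simp add: J_minus_def)
  note nz = parameter_point.pochhammer_M_nonzero[OF pp, folded M_def]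
    parameter_point.pochhammer_b_nonzero[OF pp jq, folded M_def]
    parameter_point.J_plus_denominators_nonzero[OF pp, folded M_def]
    parameter_point.J_plus_b_nonzero[OF pp j]
  have "A \<in> param_fracs p q r (param_domain p q r m)"
    unfolding A_def using nz(1,2) jq by (intro param_fracs_intros) auto
  moreover have "C \<in> param_fracs p q r (param_domain p q r m)"
    unfolding C_def using nz(1,2) jq by (intro param_fracs_intros) auto
  moreover have "E H \<in> param_fracs p q r (param_domain p q r m)" if "H \<in> J_plus q m" for H
    unfolding E_def using nz(3-5) jq that
    by (intro param_fracs_intros) (auto simp: J_plus_def)
  ultimately have "(\<lambda>x. - A x + C x * (\<Sum>H\<in>J_plus q m. E H x)) \<in> param_fracs p q r (param_domain p q r m)"
    by (intro param_fracs_intros)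
  then show ?thesis
    unfolding exceptional_set_def F by (rule algebraic_in_param_fracs)
qed

section \<open>Degrees, exceptional sets and strong normality\<close>

theorem proposition4p9:
  fixes p q r :: nat and n m :: "nat \<Rightarrow> nat"
  assumes "p \<ge> 1" and "q \<ge> 1" and "r < q"
    and "(\<Sum>j=1..q. m j) = (\<Sum>i=1..p. n i) + 1"
    and "near_diagonal q m"
  shows
    "(\<forall>x\<in>param_domain p q r m.
        poly_vec.dim (B_solutions p q r n m x) = 1 \<and>
        (\<forall>B\<in>B_solutions p q r n m x - {0}.
           (\<forall>H\<in>J_plus q m. deg (B H) = ereal (real (m H) - 1)) \<and>
           (\<forall>j\<in>{1..q}. m j \<ge> 1 \<and> deg (B j) < ereal (real (m j) - 1) \<longrightarrow> j \<in> J_minus q m) \<and>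
           (\<forall>j\<in>J_minus q m. deg (B j) < ereal (real (m j) - 1) \<longleftrightarrow> F_exc p q r n m j x = 0)))
     \<and> (finite (J_minus q m) \<and>
        (\<forall>j\<in>J_minus q m.
           algebraic_in p q r (param_domain p q r m) (exceptional_set p q r n m j)) \<and>
        (\<forall>x\<in>param_domain p q r m - (\<Union>j\<in>J_minus q m. exceptional_set p q r n m j).
           B_strongly_normal p q r n m x))
     \<and> ((\<forall>j\<in>{1..q}. \<forall>h\<in>{1..q}. m j = m h) \<longrightarrow>
          J_minus q m = {} \<and> (\<forall>x\<in>param_domain p q r m. B_strongly_normal p q r n m x))"
proof -
  have bound: "deg (B j) \<le> ereal (real (m j) - 1)"
    if "B \<in> B_solutions p q r n m x" "j \<in> {1..q}" for B x j
    using that by (auto simp: B_solutions_def)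
  have main: "poly_vec.dim (B_solutions p q r n m x) = 1 \<and>
        (\<forall>B\<in>B_solutions p q r n m x - {0}.
           (\<forall>H\<in>J_plus q m. deg (B H) = ereal (real (m H) - 1)) \<and>
           (\<forall>j\<in>{1..q}. m j \<ge> 1 \<and> deg (B j) < ereal (real (m j) - 1) \<longrightarrow> j \<in> J_minus q m) \<and>
           (\<forall>j\<in>J_minus q m. deg (B j) < ereal (real (m j) - 1) \<longleftrightarrow> F_exc p q r n m j x = 0))"
    if x: "x \<in> param_domain p q r m" for x
  proof -
    obtain a b \<kappa> where abk: "x = (a, b, \<kappa>)" by (cases x)
    interpret parameter_point p q r n m a b \<kappa>
      using assms x abk by unfold_locales simp_all
    have "(\<forall>H\<in>J_plus q m. deg (B H) = ereal (real (m H) - 1)) \<and>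
           (\<forall>j\<in>{1..q}. m j \<ge> 1 \<and> deg (B j) < ereal (real (m j) - 1) \<longrightarrow> j \<in> J_minus q m) \<and>
           (\<forall>j\<in>J_minus q m. deg (B j) < ereal (real (m j) - 1) \<longleftrightarrow> F_exc p q r n m j x = 0)"
      if B: "B \<in> B_solutions p q r n m x" "B \<noteq> 0" for B
    proof -
      have plus: "deg (B H) = ereal (real (m H) - 1)" if H: "H \<in> J_plus q m" for H
      proof -
        have H': "H \<in> {1..q}" "m H = M" using H by (auto simp: J_plus_iff)
        have "\<not> deg (B H) < ereal (real (m H) - 1)"
          using deg_less_iff_coeff[OF bound[OF B(1) H'(1)]] top_coeff_nonzero[of B H] B H H' M_pos
          by (simp add: abk)
        with bound[OF B(1) H'(1)] show ?thesis by simp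
      qed
      \<comment> \<open>A component losing degree is not in \<open>J_plus\<close>, so
        near-diagonality leaves only \<open>m j = M - 1\<close>.\<close>
      moreover have "j \<in> J_minus q m"
        if "j \<in> {1..q}" "m j \<ge> 1" "deg (B j) < ereal (real (m j) - 1)" for j
        using plus[of j] m_cases[OF that(1)] that by (auto simp: J_minus_iff J_plus_iff)
      moreover have "deg (B j) < ereal (real (m j) - 1) \<longleftrightarrow> F_exc p q r n m j x = 0"
        if j: "j \<in> J_minus q m" for j
        using deg_less_iff_coeff[OF bound[OF B(1)], of j] J_minus_criterion[of B j] B j
        by (simp add: abk J_minus_iff)
      ultimately show ?thesis by blast
    qed
    then show ?thesis
      using dim_B_solutions unfolding abk by blast
  qed
  have normal: "B_strongly_normal p q r n m x"
    if x: "x \<in> param_domain p q r m" and F: "\<And>j. j \<in> J_minus q m \<Longrightarrow> F_exc p q r n m j x \<noteq> 0" for x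
    unfolding B_strongly_normal_def
  proof (intro conjI ballI impI)
    show "poly_vec.dim (B_solutions p q r n m x) = 1"
      using main[OF x] by blast
    fix B j assume "B \<in> B_solutions p q r n m x - {0}" "j \<in> {1..q}" "1 \<le> m j"
    moreover from this have "\<not> deg (B j) < ereal (real (m j) - 1)"
      using main[OF x] F by blast
    ultimately show "deg (B j) = ereal (real (m j) - 1)"
      using bound[of B x j] by (simp add: less_le)
  qed
  have diag: "J_minus q m = {}" if "\<forall>j\<in>{1..q}. \<forall>h\<in>{1..q}. m j = m h"
  proof -
    have "max_index q m \<in> m ` {1..q}"
      using assms(2) unfolding max_index_def by (intro Max_in) auto
    then obtain h where "h \<in> {1..q}" "max_index q m = m h" by blast
    then have "m j = max_index q m" if "j \<in> {1..q}" for j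
      using that \<open>\<forall>j\<in>{1..q}. \<forall>h\<in>{1..q}. m j = m h\<close> by metis
    \<comment> \<open>In \<open>nat\<close>, \<open>M = M - 1\<close> holds only for
      \<open>M = 0\<close>, which the condition \<open>m j \<ge> 1\<close> in \<open>J_minus\<close>
      rules out.\<close>
    then show ?thesis by (force simp: J_minus_def)
  qed
  show ?thesis
  proof (rule conjI, rule ballI, erule main, intro conjI impI ballI)
    show "B_strongly_normal p q r n m x"
      if "x \<in> param_domain p q r m - (\<Union>j\<in>J_minus q m. exceptional_set p q r n m j)" for x
      using that by (intro normal) (auto simp: exceptional_set_def)
    show "B_strongly_normal p q r n m x"
      if "\<forall>j\<in>{1..q}. \<forall>h\<in>{1..q}. m j = m h" "x \<in> param_domain p q r m" for x
      using diag[OF that(1)] that(2) by (intro normal) auto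
    show "finite (J_minus q m)" by (simp add: J_minus_def)
    show "algebraic_in p q r (param_domain p q r m) (exceptional_set p q r n m j)"
      if "j \<in> J_minus q m" for j
      using algebraic_exceptional_set[OF assms(3-5) that] .
  qed (rule diag)
qed

end
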